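(* Let $\mathcal{F}$ be a 2-capturing construction scheme. If $\mathfrak{m}_{\mathcal{F}}>\omega_1$, then there are no destructible $(\omega_1,\omega_1)$-gaps.
   Context: Types: $\tau=\langle m_k,n_{k+1},r_{k+1}\rangle_{k\in\omega}$ with $m_0=1$, $n_{k+1}\ge2$, $m_k>r_{k+1}$, $m_{k+1}=r_{k+1}+(m_k-r_{k+1})n_{k+1}$, assumed good (each $r$ equals $r_k$ for infinitely many $k$). A construction scheme of type $\tau$ is a family $\mathcal{F}$ of nonempty finite subsets of $\omega_1$, cofinal under $\subseteq$, each of size some $m_k$, such that with $\mathcal{F}_k=\{F\in\mathcal{F}:|F|=m_k\}$: (i) for $E,F\in\mathcal{F}_k$, $E\cap F$ is an initial segment of both; (ii) each $F\in\mathcal{F}_{k+1}$ is $F_0\cup\dots\cup F_{n_{k+1}-1}$ with $F_i\in\mathcal{F}_k$ a $\Delta$-system with root $R(F)$, $|R(F)|=r_{k+1}$, $R(F)<F_0\setminus R(F)<\dots<F_{n_{k+1}-1}\setminus R(F)$. Let $\rho(\alpha,\beta)=\min\{k:\exists F\in\mathcal{F}_k\ \{\alpha,\beta\}\subseteq F\}$; $\|\alpha\|_k=|\{\xi<\alpha:\rho(\alpha,\xi)\le k\}|$, $\Delta(\alpha,\beta)=\min\{k:\|\alpha\|_k\ne\|\beta\|_k\}$. $\Xi_\alpha(0)=0$; for $k\ge1$ and $F\in\mathcal{F}_k$ containing $\alpha$, $\Xi_\alpha(k)=-1$ if $\alpha\in R(F)$, $=i$ if $\alpha\in F_i\setminus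 R(F)$. $D(a)$ is the $a$-th element of a finite set $D$ of ordinals. A family $\langle D_i\rangle_{i<n}$ of subsets of $\omega_1$ each of size $m$ forming a root-tail-tail $\Delta$-system (pairwise intersections equal a root $R$, $|R|=r$, $R<D_i\setminus R$, $D_0\setminus R<D_1\setminus R<\dots$) is captured at level $l$ if $\Xi_{D_i(a)}(l)=-1$ for $a<r$, $=i$ for $r\le a<m$, and $\rho(D_i(a),D_j(a))=l=\Delta(D_i(a),D_j(a))$ for $i<j<n$, $r\le a<m$. $\mathcal{F}$ is $n$-capturing if for every uncountable family $\mathcal{S}$ of finite subsets of $\omega_1$ there are infinitely many $l$ such that some $n$ members of $\mathcal{S}$ form a family captured at level $l$. $\mathfrak{m}(\mathbb{P})$ is the least $\kappa$ such that some $\kappa$ dense subsets of $\mathbb{P}$ are not all met by one filter; $\mathfrak{m}_{\mathcal{F}}$ is $\omega$ if $\mathcal{F}$ is not 2-capturing and otherwise $\min\{\mathfrak{m}(\mathbb{P}):\mathbb{P}\text{ ccc and }\mathbb{P}\Vdash\mathcal{F}\text{ is 2-capturing}\}$. An $(\omega_1,\omega_1)$-gap is a pair of $\subseteq^*$-increasing sequences $(L_\alpha,R_\alpha)_{\alpha\in\omega_1}$ of subsets of $\omega$ with all $L_\alpha\cap R_\beta$ finite and no $C\subseteq\omega$ such that $L_\alpha\setminus C$ and $C\cap R_\alpha$ are finite for all $\alpha$. It is destructible if there is an $\omega_1$-preserving forcing in some generic extension by which it is no longer a gap (i.e. it becomes separated). *)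

theory Defs
  imports "HOL-Library.Countable_Set" "HOL-Library.Infinite_Set"
begin

unbundle cardinal_syntax

section \<open>The first uncountable ordinal\<close>

text \<open>The cardinal successor of \<^term>\<open>natLeq\<close> is a well-order of type \<open>\<omega>\<^sub>1\<close>; its field is turned
  into a type.\<close>

typedef omega1 = "Field (cardSuc natLeq)"
  morphisms rep_omega1 abs_omega1
proof -
  have "\<not> finite (Field (cardSuc natLeq))"
    using cardSuc_finite[OF natLeq_Card_order] by (simp add: Field_natLeq)
  then show ?thesis by (metis ex_in_conv finite.emptyI)
qed

lemma cardSuc_natLeq_Card_order: "Card_order (cardSuc natLeq)"
  by (simp add: cardSuc_Card_order natLeq_Card_order)

lemma cardSuc_natLeq_Well_order: "Well_order (cardSuc natLeq)"
  using cardSuc_natLeq_Card_order by (simp add: card_order_on_def)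

instantiation omega1 :: linorder
begin

definition less_eq_omega1 :: "omega1 \<Rightarrow> omega1 \<Rightarrow> bool" where
  "x \<le> y \<longleftrightarrow> (rep_omega1 x, rep_omega1 y) \<in> cardSuc natLeq"

definition less_omega1 :: "omega1 \<Rightarrow> omega1 \<Rightarrow> bool" where
  "x < y \<longleftrightarrow> x \<le> y \<and> \<not> y \<le> (x::omega1)"

instance
proof
  have lin: "Linear_order (cardSuc natLeq)"
    using cardSuc_natLeq_Well_order by (simp add: well_order_on_def)
  then have tr: "trans (cardSuc natLeq)" and an: "antisym (cardSuc natLeq)"
    and re: "Refl (cardSuc natLeq)" and to: "Total (cardSuc natLeq)"
    by (simp_all add: order_on_defs)
  fix x y z :: omega1
  show "(x < y) = (x \<le> y \<and> \<not> y \<le> x)" by (fact less_omega1_def)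
  show refl: "x \<le> x"
    using re rep_omega1[of x] by (simp add: less_eq_omega1_def refl_on_def)
  show "x \<le> y \<Longrightarrow> y \<le> z \<Longrightarrow> x \<le> z"
    using tr by (auto simp: less_eq_omega1_def dest: transD)
  show "x \<le> y \<Longrightarrow> y \<le> x \<Longrightarrow> x = y"
    using an by (auto simp: less_eq_omega1_def rep_omega1_inject dest: antisymD)
  show "x \<le> y \<or> y \<le> x"
    using to refl rep_omega1[of x] rep_omega1[of y]
    by (cases "x = y") (auto simp: less_eq_omega1_def total_on_def rep_omega1_inject)
qed

end

instance omega1 :: wellorder
proof
  fix P :: "omega1 \<Rightarrow> bool" and a :: omega1
  assume step: "\<And>x. (\<And>y. y < x \<Longrightarrow> P y) \<Longrightarrow> P x"
  have wf: "wf (cardSuc natLeq - Id)"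
    using cardSuc_natLeq_Well_order by (simp add: well_order_on_def)
  have "wf (inv_image (cardSuc natLeq - Id) rep_omega1)"
    using wf by (rule wf_inv_image)
  then show "P a"
  proof (induction a rule: wf_induct_rule)
    case (less x)
    show ?case
      by (rule step, rule less)
        (auto simp: inv_image_def less_omega1_def less_eq_omega1_def)
  qed
qed

lemma uncountable_omega1: "uncountable (UNIV :: omega1 set)"
proof
  assume "countable (UNIV :: omega1 set)"
  then have "countable (range rep_omega1)" by simp
  then have "countable (Field (cardSuc natLeq))"
    using type_definition.Rep_range[OF type_definition_omega1] by simp
  then obtain f :: "nat set \<Rightarrow> nat" where "inj_on f (Field (cardSuc natLeq))"
    by (auto simp: countable_def)
  then have "|Field (cardSuc natLeq)| \<le>o |UNIV :: nat set|"
    by (auto simp flip: card_of_ordLeq)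
  then have "cardSuc natLeq \<le>o natLeq"
    using card_of_Field_ordIso[OF cardSuc_natLeq_Card_order] card_of_nat
    by (meson ordIso_symmetric ordIso_ordLeq_trans ordLeq_ordIso_trans)
  then show False
    using cardSuc_greater[OF natLeq_Card_order] not_ordLeq_ordLess by blast
qed

lemma countable_lessThan_omega1: "countable {..<x :: omega1}"
proof -
  have "|underS (cardSuc natLeq) (rep_omega1 x)| <o cardSuc natLeq"
    using card_of_underS[OF cardSuc_natLeq_Card_order] rep_omega1 by blast
  then have "|underS (cardSuc natLeq) (rep_omega1 x)| \<le>o natLeq"
    by (simp add: cardSuc_ordLeq_ordLess natLeq_Card_order card_of_Card_order)
  then have "|underS (cardSuc natLeq) (rep_omega1 x)| \<le>o |UNIV :: nat set|"
    using card_of_nat ordIso_symmetric ordLeq_ordIso_trans by blast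
  then have "countable (underS (cardSuc natLeq) (rep_omega1 x))"
    by (auto simp: countable_def simp flip: card_of_ordLeq)
  moreover have "rep_omega1 ` {..<x} \<subseteq> underS (cardSuc natLeq) (rep_omega1 x)"
    by (auto simp: underS_def less_omega1_def less_eq_omega1_def)
  ultimately have "countable (rep_omega1 ` {..<x})"
    by (rule countable_subset[rotated])
  then show ?thesis
    by (rule countable_image_inj_on) (simp add: inj_on_def rep_omega1_inject)
qed


section \<open>Construction schemes\<close>

text \<open>A type \<open>\<tau>\<close> is given by three sequences \<open>m\<close>, \<open>n\<close>, \<open>r\<close>; the values \<open>n 0\<close> and \<open>r 0\<close> are
  never used.\<close>

definition good_type :: "(nat \<Rightarrow> nat) \<Rightarrow> (nat \<Rightarrow> nat) \<Rightarrow> (nat \<Rightarrow> nat) \<Rightarrow> bool" where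
  "good_type m n r \<longleftrightarrow>
     m 0 = 1 \<and>
     (\<forall>k. n (Suc k) \<ge> 2 \<and> m k > r (Suc k) \<and>
          m (Suc k) = r (Suc k) + (m k - r (Suc k)) * n (Suc k)) \<and>
     (\<forall>j. infinite {k. r (Suc k) = j})"

definition set_less :: "omega1 set \<Rightarrow> omega1 set \<Rightarrow> bool" where
  "set_less A B \<longleftrightarrow> (\<forall>a\<in>A. \<forall>b\<in>B. a < b)"

definition initial_segment :: "omega1 set \<Rightarrow> omega1 set \<Rightarrow> bool" where
  "initial_segment A B \<longleftrightarrow> A \<subseteq> B \<and> (\<forall>x\<in>A. \<forall>y\<in>B. y < x \<longrightarrow> y \<in> A)"

text \<open>The sets \<open>D 0, \<dots>, D (N - 1)\<close> form a root-tail-tail \<open>\<Delta>\<close>-system with root \<open>Q\<close>.\<close>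

definition root_tail_tail :: "nat \<Rightarrow> (nat \<Rightarrow> omega1 set) \<Rightarrow> omega1 set \<Rightarrow> bool" where
  "root_tail_tail N D Q \<longleftrightarrow>
     (\<forall>i<N. Q \<subseteq> D i \<and> set_less Q (D i - Q)) \<and>
     (\<forall>i j. i < j \<and> j < N \<longrightarrow> D i \<inter> D j = Q \<and> set_less (D i - Q) (D j - Q))"

definition level :: "(nat \<Rightarrow> nat) \<Rightarrow> omega1 set set \<Rightarrow> nat \<Rightarrow> omega1 set set" where
  "level m F k = {A \<in> F. card A = m k}"

text \<open>\<open>canonical_decomposition m n r F k A D Q\<close>: the set \<open>A\<close> of level \<open>k + 1\<close> splits as
  \<open>A\<^sub>i = D i\<close> for \<open>i < n (k + 1)\<close> with root \<open>R(A) = Q\<close>.\<close>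

definition canonical_decomposition ::
    "(nat \<Rightarrow> nat) \<Rightarrow> (nat \<Rightarrow> nat) \<Rightarrow> (nat \<Rightarrow> nat) \<Rightarrow> omega1 set set \<Rightarrow> nat \<Rightarrow>
     omega1 set \<Rightarrow> (nat \<Rightarrow> omega1 set) \<Rightarrow> omega1 set \<Rightarrow> bool" where
  "canonical_decomposition m n r F k A D Q \<longleftrightarrow>
     (\<forall>i<n (Suc k). D i \<in> level m F k) \<and>
     A = (\<Union>i<n (Suc k). D i) \<and>
     root_tail_tail (n (Suc k)) D Q \<and>
     card Q = r (Suc k)"

definition construction_scheme ::
    "(nat \<Rightarrow> nat) \<Rightarrow> (nat \<Rightarrow> nat) \<Rightarrow> (nat \<Rightarrow> nat) \<Rightarrow> omega1 set set \<Rightarrow> bool" where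
  "construction_scheme m n r F \<longleftrightarrow>
     good_type m n r \<and>
     (\<forall>A\<in>F. finite A \<and> A \<noteq> {} \<and> (\<exists>k. card A = m k)) \<and>
     (\<forall>A. finite A \<longrightarrow> (\<exists>B\<in>F. A \<subseteq> B)) \<and>
     (\<forall>k. \<forall>A\<in>level m F k. \<forall>B\<in>level m F k.
        initial_segment (A \<inter> B) A \<and> initial_segment (A \<inter> B) B) \<and>
     (\<forall>k. \<forall>A\<in>level m F (Suc k). \<exists>D Q. canonical_decomposition m n r F k A D Q)"

definition scheme_rho :: "(nat \<Rightarrow> nat) \<Rightarrow> omega1 set set \<Rightarrow> omega1 \<Rightarrow> omega1 \<Rightarrow> nat" where
  "scheme_rho m F \<alpha> \<beta> = (LEAST k. \<exists>A\<in>level m F k. {\<alpha>, \<beta>} \<subseteq> A)"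

definition scheme_norm :: "(nat \<Rightarrow> nat) \<Rightarrow> omega1 set set \<Rightarrow> omega1 \<Rightarrow> nat \<Rightarrow> nat" where
  "scheme_norm m F \<alpha> k = card {\<xi>. \<xi> < \<alpha> \<and> scheme_rho m F \<alpha> \<xi> \<le> k}"

definition scheme_Delta :: "(nat \<Rightarrow> nat) \<Rightarrow> omega1 set set \<Rightarrow> omega1 \<Rightarrow> omega1 \<Rightarrow> nat" where
  "scheme_Delta m F \<alpha> \<beta> = (LEAST k. scheme_norm m F \<alpha> k \<noteq> scheme_norm m F \<beta> k)"

text \<open>In a construction scheme the described value exists, and it depends neither on the
  chosen member of the level nor on the decomposition.\<close>

definition scheme_Xi ::
    "(nat \<Rightarrow> nat) \<Rightarrow> (nat \<Rightarrow> nat) \<Rightarrow> (nat \<Rightarrow> nat) \<Rightarrow> omega1 set set \<Rightarrow> omega1 \<Rightarrow> nat \<Rightarrow> int" where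
  "scheme_Xi m n r F \<alpha> k =
     (case k of
        0 \<Rightarrow> 0
      | Suc k' \<Rightarrow>
          (THE v. \<exists>A\<in>level m F (Suc k'). \<alpha> \<in> A \<and>
             (\<exists>D Q. canonical_decomposition m n r F k' A D Q \<and>
                (\<alpha> \<in> Q \<and> v = -1 \<or> (\<exists>i<n (Suc k'). \<alpha> \<in> D i - Q \<and> v = int i)))))"

definition nth_elem :: "omega1 set \<Rightarrow> nat \<Rightarrow> omega1" where
  "nth_elem D a = sorted_list_of_set D ! a"

definition captured ::
    "(nat \<Rightarrow> nat) \<Rightarrow> (nat \<Rightarrow> nat) \<Rightarrow> (nat \<Rightarrow> nat) \<Rightarrow> omega1 set set \<Rightarrow>
     nat \<Rightarrow> (nat \<Rightarrow> omega1 set) \<Rightarrow> nat \<Rightarrow> bool" where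
  "captured m n r F N D l \<longleftrightarrow>
     (\<exists>s t Q.
        (\<forall>i<N. finite (D i) \<and> card (D i) = s) \<and>
        card Q = t \<and> root_tail_tail N D Q \<and>
        (\<forall>i<N. \<forall>a<t. scheme_Xi m n r F (nth_elem (D i) a) l = -1) \<and>
        (\<forall>i<N. \<forall>a. t \<le> a \<and> a < s \<longrightarrow> scheme_Xi m n r F (nth_elem (D i) a) l = int i) \<and>
        (\<forall>i j a. i < j \<and> j < N \<and> t \<le> a \<and> a < s \<longrightarrow>
           scheme_rho m F (nth_elem (D i) a) (nth_elem (D j) a) = l \<and>
           scheme_Delta m F (nth_elem (D i) a) (nth_elem (D j) a) = l))"

text \<open>The \<open>N\<close> members are required to be distinct: a constant family is a \<open>\<Delta>\<close>-system with
  empty tails.\<close>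

definition capturing ::
    "(nat \<Rightarrow> nat) \<Rightarrow> (nat \<Rightarrow> nat) \<Rightarrow> (nat \<Rightarrow> nat) \<Rightarrow> omega1 set set \<Rightarrow> nat \<Rightarrow> bool" where
  "capturing m n r F N \<longleftrightarrow>
     (\<forall>S. S \<subseteq> {A. finite A} \<and> uncountable S \<longrightarrow>
        infinite {l. \<exists>D. inj_on D {..<N} \<and> (\<forall>i<N. D i \<in> S) \<and> captured m n r F N D l})"


section \<open>Forcing notions and their Martin numbers\<close>

text \<open>A forcing notion is a nonempty preorder \<open>P\<close>, given as a relation with set of conditions
  \<^term>\<open>Field P\<close>; \<open>(q, p) \<in> P\<close> means that \<open>q\<close> is at least as strong as \<open>p\<close>.\<close>

definition forcing_notion :: "'p rel \<Rightarrow> bool" where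
  "forcing_notion P \<longleftrightarrow> Preorder P \<and> P \<noteq> {}"

definition compatible :: "'p rel \<Rightarrow> 'p \<Rightarrow> 'p \<Rightarrow> bool" where
  "compatible P p q \<longleftrightarrow> (\<exists>s. (s, p) \<in> P \<and> (s, q) \<in> P)"

definition ccc :: "'p rel \<Rightarrow> bool" where
  "ccc P \<longleftrightarrow>
     (\<forall>A \<subseteq> Field P. (\<forall>p\<in>A. \<forall>q\<in>A. p \<noteq> q \<longrightarrow> \<not> compatible P p q) \<longrightarrow> countable A)"

definition dense_in :: "'p rel \<Rightarrow> 'p set \<Rightarrow> bool" where
  "dense_in P E \<longleftrightarrow> E \<subseteq> Field P \<and> (\<forall>p\<in>Field P. \<exists>q\<in>E. (q, p) \<in> P)"

definition filter_on :: "'p rel \<Rightarrow> 'p set \<Rightarrow> bool" where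
  "filter_on P G \<longleftrightarrow>
     G \<subseteq> Field P \<and> G \<noteq> {} \<and>
     (\<forall>p\<in>G. \<forall>q. (p, q) \<in> P \<longrightarrow> q \<in> G) \<and>
     (\<forall>p\<in>G. \<forall>q\<in>G. \<exists>s\<in>G. (s, p) \<in> P \<and> (s, q) \<in> P)"

definition unmet_family :: "'p rel \<Rightarrow> 'p set set \<Rightarrow> bool" where
  "unmet_family P \<E> \<longleftrightarrow>
     (\<forall>E\<in>\<E>. dense_in P E) \<and> \<not> (\<exists>G. filter_on P G \<and> (\<forall>E\<in>\<E>. G \<inter> E \<noteq> {}))"

text \<open>\<open>martin_number P \<kappa>\<close>: the cardinal \<open>\<mm>(P)\<close> exists and equals \<open>\<kappa>\<close>.  It does not exist
  if one filter meets all dense subsets of \<open>P\<close>.\<close>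

definition martin_number :: "'p rel \<Rightarrow> 'p set rel \<Rightarrow> bool" where
  "martin_number P \<kappa> \<longleftrightarrow>
     Card_order \<kappa> \<and>
     (\<exists>\<E>. unmet_family P \<E> \<and> |\<E>| =o \<kappa>) \<and>
     (\<forall>\<E>. unmet_family P \<E> \<longrightarrow> \<kappa> \<le>o |\<E>| )"


section \<open>The forcing relation\<close>

text \<open>A statement of the forcing language over \<open>P\<close> is represented by its forcing relation, the
  predicate saying which conditions force it.  The operators below are the usual recursive
  clauses of forcing (\<open>f_ex\<close> and \<open>f_mem\<close> require density below the condition).  Every subset of
  a ground model set \<open>X\<close> lying in the generic extension has a name consisting of pairs \<open>(x, s)\<close>
  with \<open>x \<in> X\<close> and \<open>s\<close> a condition, so bounded second-order quantifiers of the extension range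
  over such sets of pairs.\<close>

type_synonym 'p fstmt = "'p \<Rightarrow> bool"

definition f_ground :: "bool \<Rightarrow> 'p fstmt" where
  "f_ground b p \<longleftrightarrow> b"

definition f_mem :: "'p rel \<Rightarrow> 'x \<Rightarrow> ('x \<times> 'p) set \<Rightarrow> 'p fstmt" where
  "f_mem P x X p \<longleftrightarrow> (\<forall>q. (q, p) \<in> P \<longrightarrow> (\<exists>t s. (t, q) \<in> P \<and> (x, s) \<in> X \<and> (t, s) \<in> P))"

definition f_not :: "'p rel \<Rightarrow> 'p fstmt \<Rightarrow> 'p fstmt" where
  "f_not P \<phi> p \<longleftrightarrow> (\<forall>q. (q, p) \<in> P \<longrightarrow> \<not> \<phi> q)"

definition f_and :: "'p fstmt \<Rightarrow> 'p fstmt \<Rightarrow> 'p fstmt" where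
  "f_and \<phi> \<psi> p \<longleftrightarrow> \<phi> p \<and> \<psi> p"

definition f_imp :: "'p rel \<Rightarrow> 'p fstmt \<Rightarrow> 'p fstmt \<Rightarrow> 'p fstmt" where
  "f_imp P \<phi> \<psi> p \<longleftrightarrow> (\<forall>q. (q, p) \<in> P \<longrightarrow> \<phi> q \<longrightarrow> \<psi> q)"

definition f_all :: "'x set \<Rightarrow> ('x \<Rightarrow> 'p fstmt) \<Rightarrow> 'p fstmt" where
  "f_all X \<phi> p \<longleftrightarrow> (\<forall>x\<in>X. \<phi> x p)"

definition f_ex :: "'p rel \<Rightarrow> 'x set \<Rightarrow> ('x \<Rightarrow> 'p fstmt) \<Rightarrow> 'p fstmt" where
  "f_ex P X \<phi> p \<longleftrightarrow> (\<forall>q. (q, p) \<in> P \<longrightarrow> (\<exists>t. (t, q) \<in> P \<and> (\<exists>x\<in>X. \<phi> x t)))"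

definition forced :: "'p rel \<Rightarrow> 'p fstmt \<Rightarrow> bool" where
  "forced P \<phi> \<longleftrightarrow> (\<forall>p\<in>Field P. \<phi> p)"

definition names :: "'p rel \<Rightarrow> 'x set \<Rightarrow> ('x \<times> 'p) set set" where
  "names P X = Pow (X \<times> Field P)"

text \<open>\<open>{x. \<phi> x}\<close> is finite: it is contained in a finite set, which may be taken in the ground
  model because forcing adds no finite sets of ground model elements.\<close>

definition f_finite :: "'p rel \<Rightarrow> ('x \<Rightarrow> 'p fstmt) \<Rightarrow> 'p fstmt" where
  "f_finite P \<phi> = f_ex P {E. finite E} (\<lambda>E. f_all (- E) (\<lambda>x. f_not P (\<phi> x)))"

text \<open>\<open>{x. \<phi> x}\<close> is countable: some function from the ground model universe of \<open>x\<close> to \<open>\<omega>\<close>,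
  whose graph has the name \<open>g\<close>, is defined and injective on this set.\<close>

definition f_countable :: "'p rel \<Rightarrow> ('x \<Rightarrow> 'p fstmt) \<Rightarrow> 'p fstmt" where
  "f_countable P \<phi> =
     f_ex P (names P (UNIV :: ('x \<times> nat) set)) (\<lambda>g.
       f_and (f_all UNIV (\<lambda>x. f_imp P (\<phi> x) (f_ex P UNIV (\<lambda>i. f_mem P (x, i) g))))
      (f_and (f_all UNIV (\<lambda>x. f_all UNIV (\<lambda>i. f_all UNIV (\<lambda>j.
                f_imp P (f_and (f_mem P (x, i) g) (f_mem P (x, j) g)) (f_ground (i = j))))))
             (f_all UNIV (\<lambda>x. f_all UNIV (\<lambda>y. f_all UNIV (\<lambda>i.
                f_imp P (f_and (f_and (\<phi> x) (\<phi> y)) (f_and (f_mem P (x, i) g) (f_mem P (y, i) g)))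
                  (f_ground (x = y))))))))"

text \<open>The ground model \<open>\<omega>\<^sub>1\<close> remains uncountable in every generic extension.\<close>

definition omega1_preserving :: "'p rel \<Rightarrow> bool" where
  "omega1_preserving P \<longleftrightarrow>
     forced P (f_not P (f_countable P (\<lambda>\<alpha> :: omega1. f_ground True)))"

text \<open>The statement of \<^term>\<open>capturing m n r F N\<close> in the extension.  No finite sets or finite
  sequences of ground model elements are added, and \<^term>\<open>captured\<close> is absolute.  As written,
  \<open>\<omega>\<^sub>1\<close> is that of the ground model, which agrees with that of the extension for
  \<open>\<omega>\<^sub>1\<close>-preserving (in particular for ccc) \<open>P\<close>.\<close>

definition f_capturing ::
    "'p rel \<Rightarrow> (nat \<Rightarrow> nat) \<Rightarrow> (nat \<Rightarrow> nat) \<Rightarrow> (nat \<Rightarrow> nat) \<Rightarrow> omega1 set set \<Rightarrow> nat \<Rightarrow>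
     'p fstmt" where
  "f_capturing P m n r F N =
     f_all (names P {A :: omega1 set. finite A}) (\<lambda>S.
       f_imp P (f_not P (f_countable P (\<lambda>A. f_mem P A S)))
         (f_not P (f_finite P (\<lambda>l :: nat.
            f_ex P {D. inj_on D {..<N}} (\<lambda>D.
              f_and (f_all {..<N} (\<lambda>i. f_mem P (D i) S))
                    (f_ground (captured m n r F N D l)))))))"

text \<open>\<open>scheme_martin_number m n r F \<kappa>\<close>: the cardinal \<open>\<mm>\<^sub>F\<close> equals \<open>\<kappa>\<close>, where forcing notions
  are taken on subsets of the type \<open>'p\<close>.  Since \<open>\<mm>\<^sub>F \<le> 2\<^sup>\<omega>\<close> (Cohen forcing), the minimum over all forcing
  notions is attained by one with at most \<open>2\<^sup>\<omega>\<close> conditions (pass to a regular suborder), so any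
  type \<open>'p\<close> into which \<^typ>\<open>omega1 set\<close> embeds yields the same cardinal.\<close>

definition scheme_martin_number ::
    "(nat \<Rightarrow> nat) \<Rightarrow> (nat \<Rightarrow> nat) \<Rightarrow> (nat \<Rightarrow> nat) \<Rightarrow> omega1 set set \<Rightarrow> 'p set rel \<Rightarrow> bool" where
  "scheme_martin_number m n r F \<kappa> \<longleftrightarrow>
     (if capturing m n r F 2
      then (\<exists>P :: 'p rel. forcing_notion P \<and> ccc P \<and> forced P (f_capturing P m n r F 2) \<and>
              martin_number P \<kappa>) \<and>
           (\<forall>P :: 'p rel. \<forall>\<mu>. forcing_notion P \<and> ccc P \<and> forced P (f_capturing P m n r F 2) \<and>
              martin_number P \<mu> \<longrightarrow> \<kappa> \<le>o \<mu>)
      else Card_order \<kappa> \<and> \<kappa> =o natLeq)"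


section \<open>Gaps\<close>

definition almost_subset :: "nat set \<Rightarrow> nat set \<Rightarrow> bool" where
  "almost_subset A B \<longleftrightarrow> finite (A - B)"

definition omega1_gap :: "(omega1 \<Rightarrow> nat set) \<Rightarrow> (omega1 \<Rightarrow> nat set) \<Rightarrow> bool" where
  "omega1_gap L R \<longleftrightarrow>
     (\<forall>\<alpha> \<beta>. \<alpha> \<le> \<beta> \<longrightarrow> almost_subset (L \<alpha>) (L \<beta>) \<and> almost_subset (R \<alpha>) (R \<beta>)) \<and>
     (\<forall>\<alpha> \<beta>. finite (L \<alpha> \<inter> R \<beta>)) \<and>
     \<not> (\<exists>C. \<forall>\<alpha>. finite (L \<alpha> - C) \<and> finite (C \<inter> R \<alpha>))"

definition f_separated ::
    "'p rel \<Rightarrow> (omega1 \<Rightarrow> nat set) \<Rightarrow> (omega1 \<Rightarrow> nat set) \<Rightarrow> 'p fstmt" where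
  "f_separated P L R =
     f_ex P (names P UNIV) (\<lambda>C.
       f_all UNIV (\<lambda>\<alpha>.
         f_and (f_finite P (\<lambda>k. f_and (f_ground (k \<in> L \<alpha>)) (f_not P (f_mem P k C))))
               (f_finite P (\<lambda>k. f_and (f_mem P k C) (f_ground (k \<in> R \<alpha>))))))"

text \<open>Some generic extension by \<open>P\<close> separates the gap iff some condition forces this.  The type
  argument is the type of the conditions.\<close>

definition destructible ::
    "'q itself \<Rightarrow> (omega1 \<Rightarrow> nat set) \<Rightarrow> (omega1 \<Rightarrow> nat set) \<Rightarrow> bool" where
  "destructible (_ :: 'q itself) L R \<longleftrightarrow>
     (\<exists>P :: 'q rel. forcing_notion P \<and> omega1_preserving P \<and>
        (\<exists>p\<in>Field P. f_separated P L R p))"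

end

(* A gap (L, R), normalised so that each L a and R a are disjoint, gives a graph on omega_1: a and b
   are joined if L a meets R b or L b meets R a.  Finite cliques of the graph form a ccc forcing
   because (L, R) is a gap, and finite independent sets form one because (L, R) is destructible.
   An uncountable independent set would separate the gap, and an uncountable clique would make it
   indestructible, so if m_F > omega_1 then neither forcing preserves 2-capturing.  This yields an
   uncountable family of finite sets D with cliques c(D), and one of sets E with independent sets
   d(E), such that members of a captured pair carry incompatible conditions.  Pair them with c(D)
   above d(E) and capture a pair of unions of D and E.  An edge between the two independent sets is
   witnessed by a number so large that it also witnesses all edges between the two higher cliques,
   which are therefore compatible: a contradiction. *)

theory Submission
  imports Defs
begin

text \<open>The two forcings fail to preserve capturing on unrelated families, so both failures must
  be brought to one level of the scheme. Capturing is a condition on each position separately; hence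
  a captured pair of unions yields captured pairs at any fixed set of positions. The order between
  c(D) and d(E) serves the almost inclusions of the gap. Let x lie in L \<gamma> and in R \<delta>,
  with \<gamma> and \<delta> from the two independent sets. Both sets show the same finite pattern
  below a number k, which forces x to be at least k; from k on, membership in L or R passes from
  \<gamma> or \<delta> to the higher points of the matching clique. One number thus serves all cross
  pairs outside a common root. Almost inclusions go upward only, which is why the cliques must be
  the higher sets. Turning preserved capturing into an uncountable clique needs omega1 dense sets of
  conditions that reach beyond a given ordinal. A finite clique may have all its extensions bounded,
  so density can fail in the whole forcing; the chain condition provides a condition
  \<open>p\<close> below which it holds.\<close>

section \<open>Uncountable families and transfinite choice\<close>

lemma uncountable_fibre:
  assumes "uncountable X" and "countable K" and "h ` X \<subseteq> K"
  shows "\<exists>c\<in>K. uncountable {x\<in>X. h x = c}"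
proof (rule ccontr)
  assume "\<not> ?thesis"
  then have "countable (\<Union>c\<in>K. {x\<in>X. h x = c})"
    using assms(2) by (intro countable_UN) auto
  moreover have "X \<subseteq> (\<Union>c\<in>K. {x\<in>X. h x = c})"
    using assms(3) by auto
  ultimately show False
    using assms(1) countable_subset by blast
qed

text \<open>Initial segments of omega1 are countable, so the values chosen before stage
  \<open>\<xi>\<close> form a set \<open>X\<close> to which the assumption applies.\<close>

lemma omega1_transfinite_choice:
  fixes T :: "omega1 \<Rightarrow> 'a \<Rightarrow> bool" and S :: "'a \<Rightarrow> 'a \<Rightarrow> bool"
  assumes "\<And>\<xi> X. countable X \<Longrightarrow> \<exists>y. T \<xi> y \<and> (\<forall>x\<in>X. S x y)"
  shows "\<exists>f. \<forall>\<xi>. T \<xi> (f \<xi>) \<and> (\<forall>\<eta><\<xi>. S (f \<eta>) (f \<xi>))"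
proof (rule dependent_wf_choice[OF wf, where P = "\<lambda>f \<xi> y. T \<xi> y \<and> (\<forall>\<eta><\<xi>. S (f \<eta>) y)"])
  fix f g :: "omega1 \<Rightarrow> 'a" and x r
  assume "\<And>z. (z, x) \<in> {(x, y). x < y} \<Longrightarrow> f z = g z"
  then show "(T x r \<and> (\<forall>\<eta><x. S (f \<eta>) r)) = (T x r \<and> (\<forall>\<eta><x. S (g \<eta>) r))"
    by auto
next
  fix x and f :: "omega1 \<Rightarrow> 'a"
  have "countable (f ` {..<x})"
    using countable_lessThan_omega1 by simp
  from assms[OF this, of x] show "\<exists>r. T x r \<and> (\<forall>\<eta><x. S (f \<eta>) r)"
    by auto
qed

lemma omega1_injective_choice:
  fixes T :: "omega1 \<Rightarrow> 'a \<Rightarrow> bool"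
  assumes "\<And>\<xi>. uncountable {y. T \<xi> y}"
  shows "\<exists>f. inj f \<and> (\<forall>\<xi>. T \<xi> (f \<xi>))"
proof -
  have "\<exists>y. T \<xi> y \<and> (\<forall>x\<in>X. x \<noteq> y)" if "countable X" for \<xi> X
  proof (rule ccontr)
    assume "\<not> ?thesis"
    then have "{y. T \<xi> y} \<subseteq> X" by auto
    with that assms show False using countable_subset by blast
  qed
  from omega1_transfinite_choice[of T "(\<noteq>)", OF this]
  obtain f where f: "\<And>\<xi>. T \<xi> (f \<xi>)" "\<And>\<xi> \<eta>. \<eta> < \<xi> \<Longrightarrow> f \<eta> \<noteq> f \<xi>"
    by auto
  have "inj f"
    by (rule injI) (metis f(2) neqE)
  with f(1) show ?thesis by blast
qed

lemma uncountable_obtain_omega1_injection: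
  assumes "uncountable X"
  obtains f :: "omega1 \<Rightarrow> 'a" where "inj f" and "range f \<subseteq> X"
  using omega1_injective_choice[of "\<lambda>_ y. y \<in> X"] assms by auto

lemma countable_atMost_omega1: "countable {..x :: omega1}"
proof -
  have "{..x} = insert x {..<x}" by auto
  then show ?thesis by (simp add: countable_lessThan_omega1)
qed

lemma countable_omega1_bounded:
  fixes X :: "omega1 set"
  assumes "countable X"
  shows "\<exists>\<beta>. \<forall>x\<in>X. x < \<beta>"
proof (rule ccontr)
  assume "\<not> ?thesis"
  then have "UNIV \<subseteq> (\<Union>x\<in>X. {..x})" by (auto simp: not_less)
  moreover have "countable (\<Union>x\<in>X. {..x})"
    using assms countable_atMost_omega1 by (intro countable_UN) auto
  ultimately show False
    using uncountable_omega1 countable_subset by blast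
qed

lemma unbounded_imp_uncountable:
  fixes X :: "omega1 set"
  assumes "\<And>\<xi>. \<exists>\<alpha>\<in>X. \<xi> \<le> \<alpha>"
  shows "uncountable X"
  using countable_omega1_bounded assms by (meson leD)

lemma uncountable_imp_unbounded:
  fixes X :: "omega1 set"
  assumes "uncountable X"
  shows "\<exists>\<alpha>\<in>X. \<xi> \<le> \<alpha>"
proof (rule ccontr)
  assume "\<not> ?thesis"
  then have "X \<subseteq> {..<\<xi>}" by auto
  then show False
    using assms countable_lessThan_omega1 countable_subset by blast
qed

text \<open>A substitute for the \<open>\<Delta>\<close>-system lemma: outside \<open>r\<close> the sets \<open>f i\<close> can be moved above any
  given ordinal.\<close>

lemma finite_sets_root:
  fixes f :: "'i \<Rightarrow> 'a set"
  assumes "uncountable I" and "\<And>i. i \<in> I \<Longrightarrow> finite (f i)"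
  obtains r J where "finite r" and "J \<subseteq> I" and "uncountable J" and "\<And>i. i \<in> J \<Longrightarrow> r \<subseteq> f i"
    and "\<And>\<alpha>. \<alpha> \<notin> r \<Longrightarrow> countable {i\<in>J. \<alpha> \<in> f i}"
proof -
  obtain N where N: "uncountable {i\<in>I. card (f i) = N}"
    using uncountable_fibre[OF assms(1), of UNIV "card \<circ> f"] by auto
  define I' where "I' = {i\<in>I. card (f i) = N}"
  \<comment> \<open>Among the finite sets contained in uncountably many of the \<open>f i\<close>,
    one of greatest size serves as root. Sizes are bounded because only indices with
    \<open>card (f i) = N\<close> are kept; a further point lying in uncountably many of the
    remaining sets could be added, against maximality.\<close>
  define G where "G r \<longleftrightarrow> finite r \<and> uncountable {i\<in>I'. r \<subseteq> f i}" for r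
  have "G {}" using N by (simp add: G_def I'_def)
  moreover have "card r < Suc N" if "G r" for r
  proof -
    have "{i\<in>I'. r \<subseteq> f i} \<noteq> {}" using that by (metis G_def countable_empty)
    then obtain i where "i \<in> I'" "r \<subseteq> f i" by auto
    then show ?thesis using assms(2) by (auto simp: I'_def less_Suc_eq_le card_mono)
  qed
  ultimately obtain r where r: "G r" "\<And>s. G s \<Longrightarrow> card s \<le> card r"
    using ex_has_greatest_nat[of G "{}" card "Suc N"] by (metis less_imp_le_nat)
  show thesis
  proof
    show "finite r" "uncountable {i\<in>I'. r \<subseteq> f i}" using r(1) by (auto simp: G_def)
    show "{i\<in>I'. r \<subseteq> f i} \<subseteq> I" by (auto simp: I'_def)
    show "countable {i \<in> {i\<in>I'. r \<subseteq> f i}. \<alpha> \<in> f i}" if "\<alpha> \<notin> r" for \<alpha>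
    proof (rule ccontr)
      assume "uncountable {i \<in> {i\<in>I'. r \<subseteq> f i}. \<alpha> \<in> f i}"
      moreover have "{i \<in> {i\<in>I'. r \<subseteq> f i}. \<alpha> \<in> f i} = {i\<in>I'. insert \<alpha> r \<subseteq> f i}" by auto
      ultimately have "G (insert \<alpha> r)" using r(1) by (simp add: G_def)
      from r(2)[OF this] show False using that r(1) by (simp add: G_def)
    qed
  qed auto
qed

lemma countable_bounded_below_root:
  fixes f :: "'i \<Rightarrow> omega1 set"
  assumes "\<And>\<alpha>. \<alpha> \<notin> r \<Longrightarrow> countable {i\<in>J. \<alpha> \<in> f i}"
  shows "countable {i\<in>J. \<exists>\<alpha>\<in>f i - r. \<alpha> \<le> \<delta>}"
proof -
  have "{i\<in>J. \<exists>\<alpha>\<in>f i - r. \<alpha> \<le> \<delta>} \<subseteq> (\<Union>\<alpha>\<in>{..\<delta>} - r. {i\<in>J. \<alpha> \<in> f i})" by auto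
  moreover have "countable (\<Union>\<alpha>\<in>{..\<delta>} - r. {i\<in>J. \<alpha> \<in> f i})"
    using assms countable_subset[OF _ countable_atMost_omega1] by (intro countable_UN) auto
  ultimately show ?thesis using countable_subset by blast
qed


section \<open>Forcing\<close>

lemma Preorder_refl: "Preorder P \<Longrightarrow> p \<in> Field P \<Longrightarrow> (p, p) \<in> P"
  by (simp add: preorder_on_def refl_on_def)

lemma Preorder_trans: "Preorder P \<Longrightarrow> (p, q) \<in> P \<Longrightarrow> (q, s) \<in> P \<Longrightarrow> (p, s) \<in> P"
  by (auto simp: preorder_on_def dest: transD)

lemma f_mem_mono: "Preorder P \<Longrightarrow> f_mem P x X p \<Longrightarrow> (q, p) \<in> P \<Longrightarrow> f_mem P x X q"
  unfolding f_mem_def using Preorder_trans by fast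

text \<open>A single name \<open>g\<close> serves at all conditions below \<open>p\<close>, so the
  density clause of \<open>f_ex\<close> needs no new witness and the three properties are only
  checked below \<open>p\<close>.\<close>

lemma f_countableI:
  fixes P :: "'q rel" and g :: "(('x \<times> nat) \<times> 'q) set"
  assumes pre: "Preorder P" and g: "g \<in> names P UNIV"
    and total: "\<And>x s. (s, p) \<in> P \<Longrightarrow> \<phi> x s \<Longrightarrow> f_ex P UNIV (\<lambda>i. f_mem P (x, i) g) s"
    and fun_g: "\<And>x i j s. (s, p) \<in> P \<Longrightarrow> f_mem P (x, i) g s \<Longrightarrow> f_mem P (x, j) g s \<Longrightarrow> i = j"
    and inj_g: "\<And>x y i s. (s, p) \<in> P \<Longrightarrow> \<phi> x s \<Longrightarrow> \<phi> y s \<Longrightarrow>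
      f_mem P (x, i) g s \<Longrightarrow> f_mem P (y, i) g s \<Longrightarrow> x = y"
  shows "f_countable P \<phi> p"
  unfolding f_countable_def f_ex_def[of _ "names P UNIV"]
proof (intro allI impI)
  fix q assume q: "(q, p) \<in> P"
  then have qq: "(q, q) \<in> P"
    by (intro Preorder_refl[OF pre]) (auto simp: Field_def)
  have tr: "(s, p) \<in> P" if "(s, q) \<in> P" for s
    using Preorder_trans[OF pre that q] .
  have "f_all UNIV (\<lambda>x. f_imp P (\<phi> x) (f_ex P UNIV (\<lambda>i. f_mem P (x, i) g))) q"
    unfolding f_all_def f_imp_def using total tr by blast
  moreover have "f_all UNIV (\<lambda>x. f_all UNIV (\<lambda>i. f_all UNIV (\<lambda>j.
      f_imp P (f_and (f_mem P (x, i) g) (f_mem P (x, j) g)) (f_ground (i = j))))) q"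
    unfolding f_all_def f_imp_def f_and_def f_ground_def using fun_g tr by blast
  moreover have "f_all UNIV (\<lambda>x. f_all UNIV (\<lambda>y. f_all UNIV (\<lambda>i.
      f_imp P (f_and (f_and (\<phi> x) (\<phi> y)) (f_and (f_mem P (x, i) g) (f_mem P (y, i) g)))
        (f_ground (x = y))))) q"
    unfolding f_all_def f_imp_def f_and_def f_ground_def using inj_g tr by blast
  ultimately show "\<exists>t. (t, q) \<in> P \<and> (\<exists>g\<in>names P (UNIV :: ('x \<times> nat) set).
      f_and (f_all UNIV (\<lambda>x. f_imp P (\<phi> x) (f_ex P UNIV (\<lambda>i. f_mem P (x, i) g))))
      (f_and (f_all UNIV (\<lambda>x. f_all UNIV (\<lambda>i. f_all UNIV (\<lambda>j.
                f_imp P (f_and (f_mem P (x, i) g) (f_mem P (x, j) g)) (f_ground (i = j))))))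
             (f_all UNIV (\<lambda>x. f_all UNIV (\<lambda>y. f_all UNIV (\<lambda>i.
                f_imp P (f_and (f_and (\<phi> x) (\<phi> y)) (f_and (f_mem P (x, i) g) (f_mem P (y, i) g)))
                  (f_ground (x = y))))))) t)"
    using g qq unfolding f_and_def[of "f_all _ _"]
    by (intro exI[of _ q] conjI bexI[of _ g])
qed

text \<open>A generic filter selects a value for each \<open>\<xi>\<close>. If no condition below
  \<open>p\<close> gave one value to two ordinals, the selected values would inject the ground model
  omega1 into the natural numbers; \<open>g\<close> names such an injection.\<close>

lemma omega1_preserving_pigeonhole_nat:
  fixes P :: "'q rel" and \<phi> :: "omega1 \<Rightarrow> nat \<Rightarrow> 'q \<Rightarrow> bool"
  assumes pre: "Preorder P" and pres: "omega1_preserving P" and p: "p \<in> Field P"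
    and mono: "\<And>\<xi> i s t. \<phi> \<xi> i s \<Longrightarrow> (t, s) \<in> P \<Longrightarrow> \<phi> \<xi> i t"
    and ex: "\<And>\<xi> s. (s, p) \<in> P \<Longrightarrow> \<exists>t i. (t, s) \<in> P \<and> \<phi> \<xi> i t"
  shows "\<exists>t \<xi> \<eta> i. (t, p) \<in> P \<and> \<xi> \<noteq> \<eta> \<and> \<phi> \<xi> i t \<and> \<phi> \<eta> i t"
proof (rule ccontr)
  assume neg: "\<not> ?thesis"
  \<comment> \<open>Taking the least value makes the name a function.\<close>
  define \<psi> where "\<psi> \<xi> i t \<longleftrightarrow> \<phi> \<xi> i t \<and> (\<forall>j<i. \<forall>s. (s, t) \<in> P \<longrightarrow> \<not> \<phi> \<xi> j s)" for \<xi> i t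
  define g where "g = {((\<xi>, i), t) | \<xi> i t. (t, p) \<in> P \<and> \<psi> \<xi> i t}"
  have \<psi>_mono: "\<psi> \<xi> i t" if "\<psi> \<xi> i s" "(t, s) \<in> P" for \<xi> i s t
    using that mono Preorder_trans[OF pre] unfolding \<psi>_def by blast
  have refl: "(t, t) \<in> P" if "(t, s) \<in> P" for t s
    using that by (intro Preorder_refl[OF pre]) (auto simp: Field_def)
  \<comment> \<open>Membership forced at \<open>s\<close> is realised by a pair of \<open>g\<close>
    only at some stronger \<open>t\<close>; two such facts are therefore combined by strengthening
    twice.\<close>
  have val: "\<exists>t. (t, s) \<in> P \<and> (t, p) \<in> P \<and> \<psi> \<xi> i t" if *: "f_mem P (\<xi>, i) g s" "(s, p) \<in> P" for \<xi> i s
  proof -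
    obtain t s' where "(t, s) \<in> P" "((\<xi>, i), s') \<in> g" "(t, s') \<in> P"
      using *(1)[unfolded f_mem_def, rule_format, OF refl[OF *(2)]] by blast
    moreover from this have "\<psi> \<xi> i s'" by (auto simp: g_def)
    ultimately show ?thesis
      using \<psi>_mono Preorder_trans[OF pre _ *(2)] by blast
  qed
  have total: "f_ex P UNIV (\<lambda>i. f_mem P (\<xi>, i) g) s" if "(s, p) \<in> P" for \<xi> s
    unfolding f_ex_def
  proof (intro allI impI)
    fix q assume qs: "(q, s) \<in> P"
    then have qp: "(q, p) \<in> P" using Preorder_trans[OF pre] that by blast
    define M where "M i \<longleftrightarrow> (\<exists>t. (t, q) \<in> P \<and> \<phi> \<xi> i t)" for i
    have "\<exists>i. M i" using ex[OF qp, of \<xi>] by (auto simp: M_def)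
    then have "M (LEAST i. M i)" by (rule LeastI_ex)
    then obtain t where t: "(t, q) \<in> P" "\<phi> \<xi> (LEAST i. M i) t" by (auto simp: M_def)
    have "\<not> \<phi> \<xi> j u" if "j < (LEAST i. M i)" "(u, t) \<in> P" for j u
      using not_less_Least[OF that(1)] Preorder_trans[OF pre that(2) t(1)] by (auto simp: M_def)
    then have "\<psi> \<xi> (LEAST i. M i) t" using t(2) by (auto simp: \<psi>_def)
    moreover have "(t, p) \<in> P" using Preorder_trans[OF pre t(1) qp] .
    ultimately have "f_mem P (\<xi>, LEAST i. M i) g t"
      unfolding f_mem_def g_def using refl \<psi>_mono Preorder_trans[OF pre] by blast
    with t(1) show "\<exists>t. (t, q) \<in> P \<and> (\<exists>i\<in>UNIV. f_mem P (\<xi>, i) g t)" by blast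
  qed
  have fun_g: "i = j" if ij: "f_mem P (\<xi>, i) g s" "f_mem P (\<xi>, j) g s" and sp: "(s, p) \<in> P" for \<xi> i j s
  proof -
    obtain t where t: "(t, s) \<in> P" "(t, p) \<in> P" "\<psi> \<xi> i t" using val[OF ij(1) sp] by blast
    then obtain u where u: "(u, t) \<in> P" "\<psi> \<xi> j u"
      using val[OF f_mem_mono[OF pre ij(2)]] by blast
    have "\<psi> \<xi> i u" using \<psi>_mono t u by blast
    with u refl[OF u(1)] show ?thesis unfolding \<psi>_def by (metis linorder_neqE_nat)
  qed
  have inj_g: "\<xi> = \<eta>" if ij: "f_mem P (\<xi>, i) g s" "f_mem P (\<eta>, i) g s" and sp: "(s, p) \<in> P" for \<xi> \<eta> i s
  proof -
    obtain t where t: "(t, s) \<in> P" "(t, p) \<in> P" "\<psi> \<xi> i t" using val[OF ij(1) sp] by blast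
    then obtain u where u: "(u, t) \<in> P" "(u, p) \<in> P" "\<psi> \<eta> i u"
      using val[OF f_mem_mono[OF pre ij(2)]] by blast
    have "\<psi> \<xi> i u" using \<psi>_mono t u by blast
    with u neg show ?thesis unfolding \<psi>_def by blast
  qed
  have "g \<in> names P UNIV" by (auto simp: names_def g_def Field_def)
  then have "f_countable P (\<lambda>\<alpha> :: omega1. f_ground True) p"
    by (rule f_countableI[OF pre _ total fun_g inj_g])
  moreover have "(p, p) \<in> P" using Preorder_refl[OF pre p] .
  ultimately show False
    using pres p by (auto simp: omega1_preserving_def forced_def f_not_def)
qed

lemma omega1_preserving_pigeonhole:
  fixes P :: "'q rel" and \<phi> :: "omega1 \<Rightarrow> 'c \<Rightarrow> 'q \<Rightarrow> bool"
  assumes "Preorder P" and "omega1_preserving P" and "p \<in> Field P" and "countable K"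
    and mono: "\<And>\<xi> c s t. \<phi> \<xi> c s \<Longrightarrow> (t, s) \<in> P \<Longrightarrow> \<phi> \<xi> c t"
    and ex: "\<And>\<xi> s. (s, p) \<in> P \<Longrightarrow> \<exists>t. \<exists>c\<in>K. (t, s) \<in> P \<and> \<phi> \<xi> c t"
  shows "\<exists>t \<xi> \<eta>. \<exists>c\<in>K. (t, p) \<in> P \<and> \<xi> \<noteq> \<eta> \<and> \<phi> \<xi> c t \<and> \<phi> \<eta> c t"
proof -
  have "\<exists>t \<xi> \<eta> i. (t, p) \<in> P \<and> \<xi> \<noteq> \<eta> \<and> (\<exists>c\<in>K. to_nat_on K c = i \<and> \<phi> \<xi> c t) \<and>
      (\<exists>c\<in>K. to_nat_on K c = i \<and> \<phi> \<eta> c t)"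
  proof (rule omega1_preserving_pigeonhole_nat[OF assms(1-3),
        where \<phi> = "\<lambda>\<xi> i t. \<exists>c\<in>K. to_nat_on K c = i \<and> \<phi> \<xi> c t"])
    show "\<exists>t i. (t, s) \<in> P \<and> (\<exists>c\<in>K. to_nat_on K c = i \<and> \<phi> \<xi> c t)" if "(s, p) \<in> P" for \<xi> s
      using ex[OF that] by blast
  qed (use mono in blast)
  then show ?thesis
    using to_nat_on_inj[OF assms(4)] by metis
qed

text \<open>Some condition \<open>t\<close> forces \<open>S\<close> to be a counterexample and fixes
  the finite set \<open>X\<close> of its capturing levels. The family \<open>\<D>\<close> collects
  the sets that some condition below \<open>t\<close> forces into \<open>S\<close>, and
  \<open>c\<close> chooses such conditions. A common lower bound of the \<open>c (D i)\<close> would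
  force a captured family into \<open>S\<close> at a level that \<open>t\<close> excludes.\<close>

lemma not_forced_capturing:
  assumes pre: "Preorder P" and nf: "\<not> forced P (f_capturing P m n r F N)" and N: "0 < N"
  obtains \<D> c X where "uncountable \<D>" and "\<And>A. A \<in> \<D> \<Longrightarrow> finite A" and "c ` \<D> \<subseteq> Field P"
    and "finite X"
    and "\<And>D l s. inj_on D {..<N} \<Longrightarrow> D ` {..<N} \<subseteq> \<D> \<Longrightarrow> captured m n r F N D l \<Longrightarrow> l \<notin> X \<Longrightarrow>
      s \<in> Field P \<Longrightarrow> \<exists>i<N. (s, c (D i)) \<notin> P"
proof -
  have tr: "(a, c) \<in> P" if "(a, b) \<in> P" "(b, c) \<in> P" for a b c
    using Preorder_trans[OF pre that] .
  have refl: "(a, a) \<in> P" if "(a, b) \<in> P" for a b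
    using that by (intro Preorder_refl[OF pre]) (auto simp: Field_def)
  obtain p S q q1 where S: "S \<in> names P {A. finite A}"
    and unc: "f_not P (f_countable P (\<lambda>A. f_mem P A S)) q" and q1: "(q1, q) \<in> P"
    and fin: "f_finite P (\<lambda>l. f_ex P {D. inj_on D {..<N}} (\<lambda>D.
              f_and (f_all {..<N} (\<lambda>i. f_mem P (D i) S)) (f_ground (captured m n r F N D l)))) q1"
    using nf unfolding forced_def f_capturing_def
    by (auto simp: f_all_def f_imp_def f_not_def[of P "f_finite P _"])
  obtain t X where t: "(t, q1) \<in> P" and X: "finite X"
    and cap: "\<And>l s. l \<notin> X \<Longrightarrow> (s, t) \<in> P \<Longrightarrow> \<not> f_ex P {D. inj_on D {..<N}} (\<lambda>D.
              f_and (f_all {..<N} (\<lambda>i. f_mem P (D i) S)) (f_ground (captured m n r F N D l))) s"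
    using fin refl[OF q1] unfolding f_finite_def f_ex_def[of P "{E. finite E}"]
    by (auto simp: f_all_def[of "- _"] f_not_def)
  define \<D> where "\<D> = {A. \<exists>s. (s, t) \<in> P \<and> f_mem P A S s}"
  define c where "c A = (SOME s. (s, t) \<in> P \<and> f_mem P A S s)" for A
  have c: "(c A, t) \<in> P" "f_mem P A S (c A)" if "A \<in> \<D>" for A
    using that someI_ex[of "\<lambda>s. (s, t) \<in> P \<and> f_mem P A S s"] by (auto simp: \<D>_def c_def)
  show thesis
  proof
    show "finite X" by fact
    show "finite A" if "A \<in> \<D>" for A
      using that S refl unfolding \<D>_def f_mem_def names_def by blast
    show "c ` \<D> \<subseteq> Field P" using c by (auto simp: Field_def)
    show "\<exists>i<N. (s, c (D i)) \<notin> P"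
      if D: "inj_on D {..<N}" "D ` {..<N} \<subseteq> \<D>" "captured m n r F N D l" "l \<notin> X" "s \<in> Field P" for D l s
    proof (rule ccontr)
      assume "\<not> ?thesis"
      then have s: "(s, c (D i)) \<in> P" if "i < N" for i using that by blast
      have st: "(s, t) \<in> P" using s[OF N] c(1) D(2) N tr by blast
      have mem: "f_mem P (D i) S q" if "i < N" "(q, s) \<in> P" for i q
        using that s c(2) D(2) f_mem_mono[OF pre] by (meson image_subset_iff lessThan_iff)
      have "f_ex P {D. inj_on D {..<N}} (\<lambda>D.
              f_and (f_all {..<N} (\<lambda>i. f_mem P (D i) S)) (f_ground (captured m n r F N D l))) s"
        using mem D(1,3) refl
        unfolding f_ex_def f_and_def f_all_def f_ground_def by blast
      with cap[OF D(4) st] show False by blast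
    qed
    show "uncountable \<D>"
    proof
      assume "countable \<D>"
      \<comment> \<open>Were \<open>\<D>\<close> countable, its ground model enumeration, as a name
        with the single condition \<open>t\<close>, would make \<open>S\<close> countable below
        \<open>t\<close>.\<close>
      define g where "g = {((A, to_nat_on \<D> A), t) | A. A \<in> \<D>}"
      have val: "A \<in> \<D> \<and> i = to_nat_on \<D> A" if "f_mem P (A, i) g s" "(s, t) \<in> P" for A i s
        using that refl unfolding f_mem_def g_def by blast
      have mem: "f_mem P (A, to_nat_on \<D> A) g s" if "A \<in> \<D>" "(s, t) \<in> P" for A s
        using that refl tr unfolding f_mem_def g_def by blast
      have total: "f_ex P UNIV (\<lambda>i. f_mem P (A, i) g) s" if "f_mem P A S s" "(s, t) \<in> P" for A s
      proof -
        have "A \<in> \<D>" using that by (auto simp: \<D>_def)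
        then show ?thesis using mem tr[OF _ that(2)] refl unfolding f_ex_def by blast
      qed
      have "g \<in> names P UNIV" using t by (auto simp: names_def g_def Field_def)
      then have "f_countable P (\<lambda>A. f_mem P A S) t"
      proof (rule f_countableI[OF pre _ total])
        show "i = j" if "(s, t) \<in> P" "f_mem P (A, i) g s" "f_mem P (A, j) g s" for A i j s
          using val that by blast
        show "A = B" if "(s, t) \<in> P" "f_mem P (A, i) g s" "f_mem P (B, i) g s" for A B i s
          using val[OF that(2,1)] val[OF that(3,1)] to_nat_on_inj[OF \<open>countable \<D>\<close>] by blast
      qed
      with unc show False using tr[OF t q1] by (auto simp: f_not_def)
    qed
  qed
qed

text \<open>An unmet family makes the Martin number of \<open>P\<close> exist, as the least
  cardinality of such a family. It is at least \<open>\<kappa>\<close> since \<open>P\<close> takes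
  part in the minimum, and at most omega1 if \<open>range E\<close> is unmet.\<close>

lemma filter_meeting_omega1_dense_sets:
  fixes P :: "'p rel" and \<kappa> :: "'p set rel" and E :: "omega1 \<Rightarrow> 'p set"
  assumes cap: "capturing m n r F 2" and mn: "scheme_martin_number m n r F \<kappa>"
    and large: "cardSuc natLeq <o \<kappa>"
    and P: "forcing_notion P" "ccc P" "forced P (f_capturing P m n r F 2)"
    and dense: "\<And>\<xi>. dense_in P (E \<xi>)"
  shows "\<exists>G. filter_on P G \<and> (\<forall>\<xi>. G \<inter> E \<xi> \<noteq> {})"
proof (rule ccontr)
  assume "\<not> ?thesis"
  then have unmet: "unmet_family P (range E)"
    using dense by (auto simp: unmet_family_def)
  let ?C = "{|\<E>| | \<E>. unmet_family P \<E>}"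
  have "?C \<noteq> {}" "\<forall>c\<in>?C. Card_order c"
    using unmet card_of_Card_order by auto
  from exists_minim_Card_order[OF this] obtain \<E> where
    "unmet_family P \<E>" and le: "\<And>\<E>'. unmet_family P \<E>' \<Longrightarrow> |\<E>| \<le>o |\<E>'|" by auto
  then have "martin_number P |\<E>|"
    using card_of_Card_order card_of_refl by (auto simp: martin_number_def)
  then have "\<kappa> \<le>o |\<E>|"
    using mn cap P by (auto simp: scheme_martin_number_def)
  also have "|\<E>| \<le>o |range E|" using le unmet by blast
  also have "|range E| \<le>o |UNIV :: omega1 set|" by (rule card_of_image)
  also have "|UNIV :: omega1 set| =o |Field (cardSuc natLeq)|"
    by (intro card_of_ordIsoI[of rep_omega1])
      (simp add: bij_betw_def inj_on_def rep_omega1_inject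
        type_definition.Rep_range[OF type_definition_omega1])
  also have "|Field (cardSuc natLeq)| =o cardSuc natLeq"
    using card_of_Field_ordIso[OF cardSuc_natLeq_Card_order] .
  finally show False using large not_ordLeq_ordLess by blast
qed


section \<open>Subfamilies of captured families\<close>

lemma sorted_list_of_set_split:
  fixes A :: "'a :: linorder set"
  assumes "finite A" and "W \<subseteq> A" and "\<And>x y. x \<in> W \<Longrightarrow> y \<in> A - W \<Longrightarrow> x < y"
  shows "sorted_list_of_set A = sorted_list_of_set W @ sorted_list_of_set (A - W)"
proof (rule sorted_distinct_set_unique)
  have W: "finite W" using assms finite_subset by blast
  then show "sorted (sorted_list_of_set W @ sorted_list_of_set (A - W))"
    using assms by (auto simp: sorted_append intro: less_imp_le)
  show "distinct (sorted_list_of_set W @ sorted_list_of_set (A - W))"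
    using assms W by auto
  show "set (sorted_list_of_set A) = set (sorted_list_of_set W @ sorted_list_of_set (A - W))"
    using assms W by auto
qed simp_all

lemma sorted_list_of_set_image:
  fixes g :: "'a :: linorder \<Rightarrow> 'b :: linorder"
  assumes "finite I" and "strict_mono_on I g"
  shows "sorted_list_of_set (g ` I) = map g (sorted_list_of_set I)"
proof (rule sorted_distinct_set_unique)
  have "inj_on g I" using assms(2) by (rule strict_mono_on_imp_inj_on)
  then show "distinct (map g (sorted_list_of_set I))"
    using assms(1) by (simp add: distinct_map)
  have "mono_on I g" using assms(2) by (rule strict_mono_on_imp_mono_on)
  then show "sorted (map g (sorted_list_of_set I))"
    using assms(1) by (intro sorted_map_mono) auto
qed (use assms(1) in auto)

lemma nth_elem_mem: "finite A \<Longrightarrow> a < card A \<Longrightarrow> nth_elem A a \<in> A"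
  using nth_mem[of a "sorted_list_of_set A"] by (simp add: nth_elem_def)

lemma strict_mono_on_nth_elem: "finite A \<Longrightarrow> strict_mono_on {..<card A} (nth_elem A)"
  by (auto simp: strict_mono_on_def nth_elem_def
      intro: sorted_wrt_nth_less[OF strict_sorted_list_of_set])

lemma ex_nth_elem: "finite A \<Longrightarrow> x \<in> A \<Longrightarrow> \<exists>a<card A. x = nth_elem A a"
  using in_set_conv_nth[of x "sorted_list_of_set A"] by (auto simp: nth_elem_def)

lemma nth_elem_initial:
  assumes "finite A" and "W \<subseteq> A" and "set_less W (A - W)"
  shows "a < card W \<Longrightarrow> nth_elem A a = nth_elem W a"
    and "card W \<le> a \<Longrightarrow> a < card A \<Longrightarrow> nth_elem A a \<in> A - W"
proof -
  have fW: "finite W" using assms finite_subset by blast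
  have split: "sorted_list_of_set A = sorted_list_of_set W @ sorted_list_of_set (A - W)"
    using assms by (intro sorted_list_of_set_split) (auto simp: set_less_def)
  show "nth_elem A a = nth_elem W a" if "a < card W"
    using that by (simp add: nth_elem_def split nth_append)
  show "nth_elem A a \<in> A - W" if "card W \<le> a" "a < card A"
  proof -
    have "a - card W < card (A - W)"
      using that by (simp add: card_Diff_subset[OF fW assms(2)])
    from nth_elem_mem[OF _ this] assms(1) that show ?thesis
      by (simp add: nth_elem_def split nth_append)
  qed
qed

text \<open>Every clause of \<open>captured\<close> speaks of one position at a time, so keeping the
  same positions \<open>I\<close> in all members preserves it; the new root consists of the kept
  positions below the old root size \<open>t\<close>. This allows two families to be captured
  through their unions. The new members may coincide when \<open>I\<close> lies within the root, so
  distinctness must be shown separately.\<close>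

lemma captured_subfamily:
  assumes cap: "captured m n r F N U l" and N: "0 < N" and I: "I \<subseteq> {..<card (U 0)}"
  shows "captured m n r F N (\<lambda>i. nth_elem (U i) ` I) l"
proof -
  obtain s t W where fin: "\<And>i. i < N \<Longrightarrow> finite (U i)" and s: "\<And>i. i < N \<Longrightarrow> card (U i) = s"
    and t: "card W = t" and rtt: "root_tail_tail N U W"
    and Xi1: "\<And>i a. i < N \<Longrightarrow> a < t \<Longrightarrow> scheme_Xi m n r F (nth_elem (U i) a) l = -1"
    and Xi2: "\<And>i a. i < N \<Longrightarrow> t \<le> a \<Longrightarrow> a < s \<Longrightarrow> scheme_Xi m n r F (nth_elem (U i) a) l = int i"
    and rD: "\<And>i j a. i < j \<Longrightarrow> j < N \<Longrightarrow> t \<le> a \<Longrightarrow> a < s \<Longrightarrow>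
           scheme_rho m F (nth_elem (U i) a) (nth_elem (U j) a) = l \<and>
           scheme_Delta m F (nth_elem (U i) a) (nth_elem (U j) a) = l"
    using cap unfolding captured_def by auto
  have W: "W \<subseteq> U i" "set_less W (U i - W)" if "i < N" for i
    using rtt that by (auto simp: root_tail_tail_def)
  have Is: "I \<subseteq> {..<s}" using I s N by auto
  then have fI: "finite I" using finite_subset by blast
  have fW: "finite W" using W(1) fin N finite_subset by blast
  define D where "D i = nth_elem (U i) ` I" for i
  define I0 where "I0 = I \<inter> {..<t}"
  define W' where "W' = nth_elem W ` I0"
  \<comment> \<open>\<open>b\<close> translates a position in \<open>D i\<close> into the position
    of the same element in \<open>U i\<close>. It sends positions below \<open>card I0\<close> into
    the old root and the remaining ones into the old tail.\<close>
  define b where "b a = sorted_list_of_set I ! a" for a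
  have root: "nth_elem (U i) a = nth_elem W a" if "i < N" "a < t" for i a
    using nth_elem_initial(1)[OF fin W] that t by simp
  have tail: "nth_elem (U i) a \<in> U i - W" if "i < N" "t \<le> a" "a < s" for i a
    using nth_elem_initial(2)[OF fin W] that t s by simp
  have monoU: "strict_mono_on I (nth_elem (U i))" if "i < N" for i
    using strict_mono_on_nth_elem[OF fin[OF that]] Is s[OF that]
    by (auto simp: strict_mono_on_def)
  have DU: "D i \<subseteq> U i" if "i < N" for i
    using nth_elem_mem[OF fin[OF that]] Is s[OF that] by (auto simp: D_def)
  have W'W: "W' \<subseteq> W"
    using nth_elem_mem[OF fW] t by (auto simp: W'_def I0_def)
  have DW: "D i \<inter> W = W'" if "i < N" for i
  proof
    show "D i \<inter> W \<subseteq> W'"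
    proof
      fix x assume "x \<in> D i \<inter> W"
      then obtain a where a: "a \<in> I" "x = nth_elem (U i) a" "x \<in> W" by (auto simp: D_def)
      then have "a < t" using tail[OF that, of a] Is by force
      then show "x \<in> W'" using a root[OF that] by (auto simp: W'_def I0_def)
    qed
    show "W' \<subseteq> D i \<inter> W"
      using W'W root[OF that] by (auto simp: W'_def D_def I0_def image_iff) metis
  qed
  have cW': "card W' = card I0"
    unfolding W'_def
    by (intro card_image strict_mono_on_imp_inj_on)
      (use strict_mono_on_nth_elem[OF fW] t in \<open>auto simp: strict_mono_on_def I0_def\<close>)
  have cD: "card (D i) = card I" if "i < N" for i
    unfolding D_def by (intro card_image strict_mono_on_imp_inj_on monoU that)
  have nthD: "nth_elem (D i) a = nth_elem (U i) (b a)" if "i < N" "a < card I" for i a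
    using sorted_list_of_set_image[OF fI monoU[OF that(1)]] that(2)
    by (simp add: nth_elem_def[of "nth_elem (U i) ` I"] D_def b_def)
  have b: "b a \<in> I" if "a < card I" for a
    using nth_mem[of a "sorted_list_of_set I"] that fI by (simp add: b_def)
  have split: "sorted_list_of_set I = sorted_list_of_set I0 @ sorted_list_of_set (I - I0)"
    by (intro sorted_list_of_set_split fI) (auto simp: I0_def)
  have cI0: "card I0 \<le> card I" using fI by (auto simp: I0_def intro: card_mono)
  have b0: "b a < t" if "a < card I0" for a
    using that nth_mem[of a "sorted_list_of_set I0"] fI
    by (auto simp: b_def split nth_append I0_def)
  have b1: "t \<le> b a" if "card I0 \<le> a" "a < card I" for a
  proof -
    have "a - card I0 < card (I - I0)"
      using that fI by (subst card_Diff_subset) (auto simp: I0_def)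
    then have "b a \<in> I - I0"
      using nth_mem[of "a - card I0" "sorted_list_of_set (I - I0)"] that fI
      by (simp add: b_def split nth_append)
    then show ?thesis by (auto simp: I0_def)
  qed
  have "captured m n r F N D l"
    unfolding captured_def
  proof (intro exI conjI allI impI)
    show "finite (D i)" for i by (simp add: D_def fI)
    show "card (D i) = card I" if "i < N" for i by (fact cD[OF that])
    show "card W' = card I0" by (fact cW')
    have sub: "D i - W' \<subseteq> U i - W" if "i < N" for i
      using DU[OF that] DW[OF that] by blast
    show "root_tail_tail N D W'"
      unfolding root_tail_tail_def
    proof (intro conjI allI impI)
      show "W' \<subseteq> D i" if "i < N" for i using DW[OF that] by blast
      show "set_less W' (D i - W')" if "i < N" for i
        using sub[OF that] W'W W(2)[OF that] unfolding set_less_def by blast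
      fix i j assume ij: "i < j \<and> j < N"
      then have "U i \<inter> U j = W" and less: "set_less (U i - W) (U j - W)"
        using rtt by (auto simp: root_tail_tail_def)
      then show "D i \<inter> D j = W'"
        using DU[of i] DU[of j] DW[of i] DW[of j] ij by auto
      show "set_less (D i - W') (D j - W')"
        using less sub[of i] sub[of j] ij unfolding set_less_def by auto
    qed
    show "scheme_Xi m n r F (nth_elem (D i) a) l = - 1" if "i < N" "a < card I0" for i a
      using Xi1 nthD b0 that cI0 by simp
    show "scheme_Xi m n r F (nth_elem (D i) a) l = int i"
      if "i < N" "card I0 \<le> a \<and> a < card I" for i a
      using Xi2 nthD b1 b that Is by force
    fix i j a assume "i < j \<and> j < N \<and> card I0 \<le> a \<and> a < card I"
    then have "scheme_rho m F (nth_elem (D i) a) (nth_elem (D j) a) = l \<and>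
           scheme_Delta m F (nth_elem (D i) a) (nth_elem (D j) a) = l"
      using rD[of i j "b a"] nthD[of i a] nthD[of j a] b1[of a] b[of a] Is by force
    then show "scheme_rho m F (nth_elem (D i) a) (nth_elem (D j) a) = l"
      and "scheme_Delta m F (nth_elem (D i) a) (nth_elem (D j) a) = l" by auto
  qed
  then show ?thesis by (simp add: D_def[abs_def])
qed


section \<open>Forcing with finite cliques\<close>

definition clique :: "('a \<Rightarrow> 'a \<Rightarrow> bool) \<Rightarrow> 'a set \<Rightarrow> bool" where
  "clique e A \<longleftrightarrow> (\<forall>\<alpha>\<in>A. \<forall>\<beta>\<in>A. \<alpha> \<noteq> \<beta> \<longrightarrow> e \<alpha> \<beta>)"

text \<open>The base \<open>p\<close> is a weakest condition: it allows the forcing to be taken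
  below \<open>p\<close>, with \<open>{}\<close> for the whole forcing.\<close>

definition finite_cliques :: "('a \<Rightarrow> 'a \<Rightarrow> bool) \<Rightarrow> 'a set \<Rightarrow> 'a set set" where
  "finite_cliques e p = {A. finite A \<and> p \<subseteq> A \<and> clique e A}"

text \<open>The countable chain condition for all finite cliques under reverse inclusion: a subset
  of a clique is a clique, so two conditions are compatible exactly when their union is one.\<close>

definition clique_ccc :: "('a \<Rightarrow> 'a \<Rightarrow> bool) \<Rightarrow> bool" where
  "clique_ccc e \<longleftrightarrow> (\<forall>\<A> \<subseteq> finite_cliques e {}. uncountable \<A> \<longrightarrow>
     (\<exists>a\<in>\<A>. \<exists>b\<in>\<A>. a \<noteq> b \<and> clique e (a \<union> b)))"

lemma clique_cccD:
  assumes "clique_ccc e" and "uncountable \<A>" and "\<A> \<subseteq> finite_cliques e {}"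
  obtains a b where "a \<in> \<A>" and "b \<in> \<A>" and "a \<noteq> b" and "clique e (a \<union> b)"
  using assms(1)[unfolded clique_ccc_def, rule_format, OF assms(3,2)] that by blast

text \<open>The conditions are transported along \<open>f\<close> to the type over which the Martin number is taken.\<close>

definition clique_forcing :: "('a set \<Rightarrow> 'p) \<Rightarrow> ('a \<Rightarrow> 'a \<Rightarrow> bool) \<Rightarrow> 'a set \<Rightarrow> 'p rel" where
  "clique_forcing f e p = {(f a, f b) | a b. a \<in> finite_cliques e p \<and> b \<in> finite_cliques e p \<and> b \<subseteq> a}"

lemma Field_clique_forcing: "Field (clique_forcing f e p) = f ` finite_cliques e p"
  by (auto simp: Field_def clique_forcing_def Domain_iff Range_iff image_iff)

lemma clique_forcing_iff:
  assumes "inj f"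
  shows "(f a, f b) \<in> clique_forcing f e p \<longleftrightarrow>
    a \<in> finite_cliques e p \<and> b \<in> finite_cliques e p \<and> b \<subseteq> a"
  using assms by (auto simp: clique_forcing_def inj_eq)

lemma forcing_notion_clique_forcing:
  assumes "inj f" and "p \<in> finite_cliques e p"
  shows "forcing_notion (clique_forcing f e p)"
proof -
  have "trans (clique_forcing f e p)"
    using assms(1) by (auto simp: trans_def clique_forcing_def inj_eq)
  moreover have "refl_on (Field (clique_forcing f e p)) (clique_forcing f e p)"
    by (auto simp: refl_on_def Field_clique_forcing clique_forcing_iff[OF assms(1)])
  moreover have "clique_forcing f e p \<subseteq> Field (clique_forcing f e p) \<times> Field (clique_forcing f e p)"
    by (auto simp: Field_def)
  ultimately have "Preorder (clique_forcing f e p)"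
    by (simp add: preorder_on_def)
  moreover have "clique_forcing f e p \<noteq> {}"
    using assms(2) by (auto simp: clique_forcing_def)
  ultimately show ?thesis by (simp add: forcing_notion_def)
qed

lemma finite_cliques_Un:
  "a \<in> finite_cliques e p \<Longrightarrow> b \<in> finite_cliques e p \<Longrightarrow> clique e (a \<union> b) \<Longrightarrow>
    a \<union> b \<in> finite_cliques e p"
  by (auto simp: finite_cliques_def)

lemma ccc_clique_forcing:
  assumes f: "inj f" and ccc: "clique_ccc e"
  shows "ccc (clique_forcing f e p)"
  unfolding ccc_def
proof (intro allI impI)
  fix A assume A: "A \<subseteq> Field (clique_forcing f e p)"
    and anti: "\<forall>x\<in>A. \<forall>y\<in>A. x \<noteq> y \<longrightarrow> \<not> compatible (clique_forcing f e p) x y"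
  define \<A> where "\<A> = {a \<in> finite_cliques e p. f a \<in> A}"
  have "f ` \<A> = A" using A by (auto simp: \<A>_def Field_clique_forcing)
  moreover have "countable \<A>"
  proof (rule ccontr)
    assume "uncountable \<A>"
    moreover have "\<A> \<subseteq> finite_cliques e {}" by (auto simp: \<A>_def finite_cliques_def)
    ultimately obtain a b where ab: "a \<in> \<A>" "b \<in> \<A>" "a \<noteq> b" "clique e (a \<union> b)"
      by (rule clique_cccD[OF ccc])
    then have "a \<union> b \<in> finite_cliques e p"
      by (intro finite_cliques_Un) (auto simp: \<A>_def)
    then have "compatible (clique_forcing f e p) (f a) (f b)"
      using ab unfolding compatible_def
      by (intro exI[of _ "f (a \<union> b)"]) (auto simp: clique_forcing_iff[OF f] \<A>_def)
    moreover have "f a \<noteq> f b" using ab f by (auto dest: injD)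
    ultimately show False using anti ab by (auto simp: \<A>_def)
  qed
  ultimately show "countable A" using countable_image[of \<A> f] by simp
qed

text \<open>Some singleton works as \<open>p\<close>. Otherwise each \<open>{\<alpha>}\<close> has
  an extension \<open>a \<alpha>\<close> whose own extensions all stay below a bound
  \<open>\<xi> \<alpha>\<close>, and this produces an uncountable antichain.\<close>

lemma clique_ccc_generic_uncountable:
  fixes e :: "omega1 \<Rightarrow> omega1 \<Rightarrow> bool"
  assumes ccc: "clique_ccc e"
  obtains p where "p \<in> finite_cliques e p"
    and "\<And>a \<xi>. a \<in> finite_cliques e p \<Longrightarrow> \<exists>b\<in>finite_cliques e p. a \<subseteq> b \<and> (\<exists>\<alpha>\<in>b. \<xi> \<le> \<alpha>)"
proof (rule ccontr)
  assume no: "\<not> thesis"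
  have "\<exists>a \<xi>. a \<in> finite_cliques e {\<alpha>} \<and>
      \<not> (\<exists>b\<in>finite_cliques e {\<alpha>}. a \<subseteq> b \<and> (\<exists>\<beta>\<in>b. \<xi> \<le> \<beta>))" for \<alpha>
  proof (rule ccontr)
    assume "\<not> ?thesis"
    then have "\<exists>b\<in>finite_cliques e {\<alpha>}. a \<subseteq> b \<and> (\<exists>\<beta>\<in>b. \<xi> \<le> \<beta>)"
      if "a \<in> finite_cliques e {\<alpha>}" for a \<xi> using that by blast
    moreover have "{\<alpha>} \<in> finite_cliques e {\<alpha>}" by (simp add: finite_cliques_def clique_def)
    ultimately show False using that[of "{\<alpha>}"] no by blast
  qed
  then obtain a \<xi> where a: "\<And>\<alpha>. a \<alpha> \<in> finite_cliques e {\<alpha>}"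
    and "\<And>\<alpha>. \<not> (\<exists>b\<in>finite_cliques e {\<alpha>}. a \<alpha> \<subseteq> b \<and> (\<exists>\<beta>\<in>b. \<xi> \<alpha> \<le> \<beta>))"
    by metis
  then have \<xi>: "\<beta> < \<xi> \<alpha>" if "b \<in> finite_cliques e {\<alpha>}" "a \<alpha> \<subseteq> b" "\<beta> \<in> b" for \<alpha> b \<beta>
    using that not_le by blast
  \<comment> \<open>The ordinals \<open>g y\<close> are chosen at or above the bounds of all earlier
    ones. Since \<open>a (g y)\<close> contains \<open>g y\<close>, it is incompatible with every
    earlier \<open>a (g x)\<close>.\<close>
  have ub: "\<exists>y. True \<and> (\<forall>x\<in>X. \<xi> x \<le> y)" if "countable X" for X
    using countable_omega1_bounded[of "\<xi> ` X"] that by (auto intro: less_imp_le)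
  have "\<exists>g. \<forall>y :: omega1. True \<and> (\<forall>x<y. \<xi> (g x) \<le> g y)"
    by (rule omega1_transfinite_choice[where T = "\<lambda>_ _. True" and S = "\<lambda>x y. \<xi> x \<le> y"], rule ub)
  then obtain g :: "omega1 \<Rightarrow> omega1" where g: "\<And>x y. x < y \<Longrightarrow> \<xi> (g x) \<le> g y" by blast
  have incompat: "\<not> clique e (a (g x) \<union> a (g y))" if "x < y" for x y
  proof
    assume "clique e (a (g x) \<union> a (g y))"
    then have "a (g x) \<union> a (g y) \<in> finite_cliques e {g x}"
      using a by (auto simp: finite_cliques_def)
    moreover have "g y \<in> a (g y)" using a by (auto simp: finite_cliques_def)
    ultimately have "g y < \<xi> (g x)" using \<xi> by blast
    with g[OF that] show False by simp
  qed
  have "inj (\<lambda>x. a (g x))"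
  proof (rule injI)
    fix x y assume eq: "a (g x) = a (g y)"
    have "clique e (a (g x) \<union> a (g y))" using a eq by (auto simp: finite_cliques_def)
    then show "x = y" using incompat[of x y] incompat[of y x] by (metis Un_commute neqE)
  qed
  then have "uncountable (range (\<lambda>x. a (g x)))"
    using uncountable_omega1 by (simp add: countable_image_inj_eq)
  moreover have "range (\<lambda>x. a (g x)) \<subseteq> finite_cliques e {}"
    using a by (auto simp: finite_cliques_def)
  ultimately obtain x y where "a (g x) \<noteq> a (g y)" "clique e (a (g x) \<union> a (g y))"
    by (rule clique_cccD[OF ccc]) auto
  then show False using incompat[of x y] incompat[of y x] by (metis Un_commute neqE)
qed

text \<open>The union of the conditions in a filter is a clique, because any two of them have a
  common extension. Meeting the sets \<open>E \<xi>\<close> makes it unbounded in omega1;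
  \<open>ext\<close> is their density.\<close>

lemma uncountable_clique_of_capturing:
  fixes \<kappa> :: "'p set rel" and f :: "omega1 set \<Rightarrow> 'p"
  assumes f: "inj f" and cap: "capturing m n r F 2" "scheme_martin_number m n r F \<kappa>"
      "cardSuc natLeq <o \<kappa>"
    and ccc: "clique_ccc e" and p: "p \<in> finite_cliques e p"
    and ext: "\<And>a \<xi>. a \<in> finite_cliques e p \<Longrightarrow> \<exists>b\<in>finite_cliques e p. a \<subseteq> b \<and> (\<exists>\<alpha>\<in>b. \<xi> \<le> \<alpha>)"
    and forced: "forced (clique_forcing f e p) (f_capturing (clique_forcing f e p) m n r F 2)"
  obtains A where "uncountable A" and "clique e A"
proof -
  define E where "E \<xi> = f ` {b\<in>finite_cliques e p. \<exists>\<alpha>\<in>b. \<xi> \<le> \<alpha>}" for \<xi>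
  have "dense_in (clique_forcing f e p) (E \<xi>)" for \<xi>
    unfolding dense_in_def
  proof (intro conjI ballI)
    show "E \<xi> \<subseteq> Field (clique_forcing f e p)" by (auto simp: E_def Field_clique_forcing)
    fix x assume "x \<in> Field (clique_forcing f e p)"
    then obtain a where a: "a \<in> finite_cliques e p" "x = f a" by (auto simp: Field_clique_forcing)
    from ext[OF a(1), of \<xi>] obtain b where b: "b \<in> finite_cliques e p" "a \<subseteq> b" "\<exists>\<alpha>\<in>b. \<xi> \<le> \<alpha>"
      by blast
    then have "f b \<in> E \<xi>" by (simp add: E_def)
    moreover have "(f b, x) \<in> clique_forcing f e p"
      using a b by (simp add: clique_forcing_iff[OF f])
    ultimately show "\<exists>q\<in>E \<xi>. (q, x) \<in> clique_forcing f e p" by blast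
  qed
  then have "\<exists>G. filter_on (clique_forcing f e p) G \<and> (\<forall>\<xi>. G \<inter> E \<xi> \<noteq> {})"
    by (rule filter_meeting_omega1_dense_sets[OF cap forcing_notion_clique_forcing[OF f p]
          ccc_clique_forcing[OF f ccc] forced])
  then obtain G where G: "filter_on (clique_forcing f e p) G" and meet: "\<And>\<xi>. G \<inter> E \<xi> \<noteq> {}"
    by blast
  define A where "A = \<Union>{a. a \<in> finite_cliques e p \<and> f a \<in> G}"
  show thesis
  proof
    show "uncountable A"
    proof (rule unbounded_imp_uncountable)
      show "\<exists>\<alpha>\<in>A. \<xi> \<le> \<alpha>" for \<xi> using meet[of \<xi>] by (auto simp: A_def E_def)
    qed
    show "clique e A"
      unfolding clique_def
    proof (intro ballI impI)
      fix \<alpha> \<beta> assume \<alpha>\<beta>: "\<alpha> \<in> A" "\<beta> \<in> A" "\<alpha> \<noteq> \<beta>"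
      then obtain a b where ab: "\<alpha> \<in> a" "f a \<in> G" "\<beta> \<in> b" "f b \<in> G" by (auto simp: A_def)
      then obtain x where x: "(x, f a) \<in> clique_forcing f e p" "(x, f b) \<in> clique_forcing f e p"
        using G unfolding filter_on_def by blast
      then obtain c where "x = f c" by (auto simp: clique_forcing_def)
      with x have "a \<subseteq> c" "b \<subseteq> c" "clique e c"
        by (auto simp: clique_forcing_iff[OF f] finite_cliques_def)
      with ab \<alpha>\<beta>(3) show "e \<alpha> \<beta>" by (auto simp: clique_def)
    qed
  qed
qed

text \<open>\<open>not_forced_capturing\<close> freed from the transport \<open>f\<close>: if the
  union of the two attached cliques were a clique, it would be a common lower bound.\<close>

lemma clique_forcing_not_capturing:
  assumes f: "inj f" and p: "p \<in> finite_cliques e p"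
    and nf: "\<not> forced (clique_forcing f e p) (f_capturing (clique_forcing f e p) m n r F 2)"
  obtains \<D> c X where "uncountable \<D>" and "\<And>A. A \<in> \<D> \<Longrightarrow> finite A"
    and "\<And>A. A \<in> \<D> \<Longrightarrow> finite (c A) \<and> clique e (c A)" and "finite X"
    and "\<And>D l. inj_on D {..<2} \<Longrightarrow> D ` {..<2} \<subseteq> \<D> \<Longrightarrow> captured m n r F 2 D l \<Longrightarrow> l \<notin> X \<Longrightarrow>
      \<not> clique e (c (D 0) \<union> c (D (1::nat)))"
proof -
  have pre: "Preorder (clique_forcing f e p)"
    using forcing_notion_clique_forcing[OF f p] by (simp add: forcing_notion_def)
  obtain \<D> c X where \<D>: "uncountable \<D>" "\<And>A. A \<in> \<D> \<Longrightarrow> finite A"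
    and c: "c ` \<D> \<subseteq> Field (clique_forcing f e p)" and X: "finite X"
    and inc: "\<And>D l s. inj_on D {..<2} \<Longrightarrow> D ` {..<2} \<subseteq> \<D> \<Longrightarrow> captured m n r F 2 D l \<Longrightarrow> l \<notin> X \<Longrightarrow>
      s \<in> Field (clique_forcing f e p) \<Longrightarrow> \<exists>i<2. (s, c (D i)) \<notin> clique_forcing f e p"
    using not_forced_capturing[OF pre nf] by (metis zero_less_numeral)
  have "\<forall>A\<in>\<D>. \<exists>a. a \<in> finite_cliques e p \<and> c A = f a"
    using c by (auto simp: Field_clique_forcing)
  then obtain d where d: "\<And>A. A \<in> \<D> \<Longrightarrow> d A \<in> finite_cliques e p \<and> c A = f (d A)"
    by metis
  show thesis
  proof (rule that[of \<D> d X, OF \<D>(1) \<D>(2) _ X])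
    show "finite (d A) \<and> clique e (d A)" if "A \<in> \<D>" for A
      using d[OF that] by (auto simp: finite_cliques_def)
    fix D :: "nat \<Rightarrow> _" and l
    assume D: "inj_on D {..<2}" "D ` {..<2} \<subseteq> \<D>" "captured m n r F 2 D l" "l \<notin> X"
    show "\<not> clique e (d (D 0) \<union> d (D 1))"
    proof
      assume "clique e (d (D 0) \<union> d (D 1))"
      moreover have mem: "D i \<in> \<D>" if "i < 2" for i using D(2) that by auto
      ultimately have u: "d (D 0) \<union> d (D 1) \<in> finite_cliques e p"
        using d by (intro finite_cliques_Un) auto
      then have "f (d (D 0) \<union> d (D 1)) \<in> Field (clique_forcing f e p)"
        by (simp add: Field_clique_forcing)
      from inc[OF D this] obtain i where i: "i < 2"
        "(f (d (D 0) \<union> d (D 1)), c (D i)) \<notin> clique_forcing f e p" by blast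
      then have "i = 0 \<or> i = 1" by auto
      then show False
        using i u d[OF mem[OF i(1)]] by (auto simp: clique_forcing_iff[OF f])
    qed
  qed
qed


section \<open>The two orientations of a gap\<close>

definition gap_edge :: "('a \<Rightarrow> nat set) \<Rightarrow> ('a \<Rightarrow> nat set) \<Rightarrow> 'a \<Rightarrow> 'a \<Rightarrow> bool" where
  "gap_edge L R \<alpha> \<beta> \<longleftrightarrow> L \<alpha> \<inter> R \<beta> \<noteq> {} \<or> L \<beta> \<inter> R \<alpha> \<noteq> {}"

abbreviation gap_nonedge :: "('a \<Rightarrow> nat set) \<Rightarrow> ('a \<Rightarrow> nat set) \<Rightarrow> 'a \<Rightarrow> 'a \<Rightarrow> bool" where
  "gap_nonedge L R \<alpha> \<beta> \<equiv> \<not> gap_edge L R \<alpha> \<beta>"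

lemma gap_edge_commute: "gap_edge L R \<alpha> \<beta> \<longleftrightarrow> gap_edge L R \<beta> \<alpha>"
  by (auto simp: gap_edge_def)

lemma clique_Un:
  assumes "clique e A" and "clique e B" and sym: "\<And>\<alpha> \<beta>. e \<alpha> \<beta> \<Longrightarrow> e \<beta> \<alpha>"
    and cross: "\<And>\<alpha> \<beta>. \<alpha> \<in> A - B \<Longrightarrow> \<beta> \<in> B - A \<Longrightarrow> e \<alpha> \<beta>"
  shows "clique e (A \<union> B)"
  unfolding clique_def
proof (intro ballI impI)
  fix \<alpha> \<beta> assume *: "\<alpha> \<in> A \<union> B" "\<beta> \<in> A \<union> B" "\<alpha> \<noteq> \<beta>"
  consider "\<alpha> \<in> A" "\<beta> \<in> A" | "\<alpha> \<in> B" "\<beta> \<in> B" | "\<alpha> \<in> A - B" "\<beta> \<in> B - A" | "\<alpha> \<in> B - A" "\<beta> \<in> A - B"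
    using *(1,2) by blast
  then show "e \<alpha> \<beta>"
    using assms(1,2) *(3) sym cross by cases (auto simp: clique_def)
qed

section \<open>Almost inclusions, separation and normalisation of a gap\<close>

lemma omega1_gap_almost_subset:
  assumes "omega1_gap L R" and "\<alpha> \<le> \<beta>"
  shows "finite (L \<alpha> - L \<beta>)" and "finite (R \<alpha> - R \<beta>)"
  using assms by (auto simp: omega1_gap_def almost_subset_def)

lemma omega1_gap_not_separated:
  assumes "omega1_gap L R"
    and "\<And>\<delta>. finite (L \<delta> - C)" and "\<And>\<delta>. finite (C \<inter> R \<delta>)"
  shows False
  using assms unfolding omega1_gap_def by blast

text \<open>Each \<open>R \<alpha>\<close> loses only a finite set, so almost inclusions and
  inseparability survive. Disjointness means that no point is joined to itself by
  \<open>gap_edge\<close>.\<close>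

lemma omega1_gap_disjointify:
  assumes gap: "omega1_gap L R"
  shows "omega1_gap L (\<lambda>\<alpha>. R \<alpha> - L \<alpha>)"
  unfolding omega1_gap_def
proof (intro conjI allI impI)
  have fin: "finite (L \<alpha> \<inter> R \<beta>)" for \<alpha> \<beta> using gap by (auto simp: omega1_gap_def)
  fix \<alpha> \<beta> :: omega1
  show "finite (L \<alpha> \<inter> (R \<beta> - L \<beta>))"
    by (rule finite_subset[OF _ fin[of \<alpha> \<beta>]]) auto
  show "almost_subset (L \<alpha>) (L \<beta>)" if "\<alpha> \<le> \<beta>"
    using gap that by (auto simp: omega1_gap_def)
  show "almost_subset (R \<alpha> - L \<alpha>) (R \<beta> - L \<beta>)" if "\<alpha> \<le> \<beta>"
    unfolding almost_subset_def
    by (rule finite_subset[of _ "(R \<alpha> - R \<beta>) \<union> (L \<beta> \<inter> R \<alpha>)"])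
      (use omega1_gap_almost_subset[OF gap that] fin in auto)
next
  show "\<nexists>C. \<forall>\<alpha>. finite (L \<alpha> - C) \<and> finite (C \<inter> (R \<alpha> - L \<alpha>))"
  proof
    assume "\<exists>C. \<forall>\<alpha>. finite (L \<alpha> - C) \<and> finite (C \<inter> (R \<alpha> - L \<alpha>))"
    then obtain C where C: "\<And>\<alpha>. finite (L \<alpha> - C)" "\<And>\<alpha>. finite (C \<inter> (R \<alpha> - L \<alpha>))" by blast
    have "finite (L \<delta> \<inter> R \<delta>)" for \<delta> using gap by (auto simp: omega1_gap_def)
    then have "finite ((C \<inter> (R \<delta> - L \<delta>)) \<union> (L \<delta> \<inter> R \<delta>))" for \<delta>
      using C(2) by simp
    then have "finite (C \<inter> R \<delta>)" for \<delta>
      by (rule finite_subset[rotated]) auto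
    then show False by (rule omega1_gap_not_separated[OF gap C(1)])
  qed
qed

text \<open>A number in \<open>Linf p \<inter> Rinf q\<close> witnesses all edges between
  \<open>p\<close> and \<open>q\<close> outside the root at once. If there were none for any
  \<open>p\<close> and \<open>q\<close>, the union of the \<open>Linf p\<close> would separate the
  gap: for each \<open>\<delta>\<close> some \<open>p\<close> lies above \<open>\<delta>\<close>
  outside the root, so almost all of \<open>L \<delta>\<close> is in \<open>Linf p\<close> and
  almost all of \<open>R \<delta>\<close> is in \<open>Rinf p\<close>.\<close>

lemma gap_edge_ccc:
  assumes gap: "omega1_gap L R" and disj: "\<And>\<alpha>. L \<alpha> \<inter> R \<alpha> = {}"
  shows "clique_ccc (gap_edge L R)"
  unfolding clique_ccc_def
proof (intro allI impI)
  fix \<A> assume \<A>: "\<A> \<subseteq> finite_cliques (gap_edge L R) {}" "uncountable \<A>"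
  have fin: "finite p" if "p \<in> \<A>" for p using that \<A>(1) by (auto simp: finite_cliques_def)
  obtain r J where "finite r" and J: "J \<subseteq> \<A>" "uncountable J" "\<And>p. p \<in> J \<Longrightarrow> r \<subseteq> p"
    and cnt: "\<And>\<alpha>. \<alpha> \<notin> r \<Longrightarrow> countable {p\<in>J. \<alpha> \<in> p}"
    by (rule finite_sets_root[OF \<A>(2), of "\<lambda>p. p", OF fin]; blast)
  define Linf Rinf where "Linf p = {x. \<forall>\<alpha>\<in>p - r. x \<in> L \<alpha>}" and "Rinf p = {x. \<forall>\<alpha>\<in>p - r. x \<in> R \<alpha>}" for p
  \<comment> \<open>The set \<open>r\<close> itself is discarded: \<open>Linf r\<close> and
    \<open>Rinf r\<close> are the set of all numbers, whereas a point of \<open>p - r\<close> later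
    excludes \<open>p = q\<close>.\<close>
  have unb: "\<exists>p\<in>J - {r}. \<forall>\<alpha>\<in>p - r. \<delta> \<le> \<alpha>" for \<delta>
  proof (rule ccontr)
    assume no: "\<not> ?thesis"
    have "J \<subseteq> insert r {p\<in>J. \<exists>\<alpha>\<in>p - r. \<alpha> \<le> \<delta>}"
    proof
      fix p assume "p \<in> J"
      moreover from this no have "\<exists>\<alpha>\<in>p - r. \<not> \<delta> \<le> \<alpha>" if "p \<noteq> r" using that by blast
      ultimately show "p \<in> insert r {p\<in>J. \<exists>\<alpha>\<in>p - r. \<alpha> \<le> \<delta>}"
        using le_cases by blast
    qed
    moreover have "countable {p\<in>J. \<exists>\<alpha>\<in>p - r. \<alpha> \<le> \<delta>}"
      by (rule countable_bounded_below_root[OF cnt])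
    then have "countable (insert r {p\<in>J. \<exists>\<alpha>\<in>p - r. \<alpha> \<le> \<delta>})" by simp
    ultimately show False using J(2) countable_subset by blast
  qed
  have "\<exists>p\<in>J - {r}. \<exists>q\<in>J - {r}. Linf p \<inter> Rinf q \<noteq> {}"
  proof (rule ccontr)
    assume "\<not> ?thesis"
    then have empty: "Linf p \<inter> Rinf q = {}" if "p \<in> J - {r}" "q \<in> J - {r}" for p q
      using that by blast
    define C where "C = (\<Union>p\<in>J - {r}. Linf p)"
    have "finite (L \<delta> - C)" for \<delta>
    proof -
      obtain p where p: "p \<in> J - {r}" "\<forall>\<alpha>\<in>p - r. \<delta> \<le> \<alpha>" using unb by blast
      then have "L \<delta> - C \<subseteq> (\<Union>\<alpha>\<in>p - r. L \<delta> - L \<alpha>)" by (auto simp: C_def Linf_def)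
      moreover have "finite (\<Union>\<alpha>\<in>p - r. L \<delta> - L \<alpha>)"
        using p fin J(1) omega1_gap_almost_subset(1)[OF gap] by (intro finite_UN_I) auto
      ultimately show ?thesis using finite_subset by blast
    qed
    moreover have "finite (C \<inter> R \<delta>)" for \<delta>
    proof -
      obtain p where p: "p \<in> J - {r}" "\<forall>\<alpha>\<in>p - r. \<delta> \<le> \<alpha>" using unb by blast
      have "C \<inter> Rinf p = {}" using empty p(1) by (auto simp: C_def)
      then have "C \<inter> R \<delta> \<subseteq> (\<Union>\<alpha>\<in>p - r. R \<delta> - R \<alpha>)" by (auto simp: Rinf_def)
      moreover have "finite (\<Union>\<alpha>\<in>p - r. R \<delta> - R \<alpha>)"
        using p fin J(1) omega1_gap_almost_subset(2)[OF gap] by (intro finite_UN_I) auto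
      ultimately show ?thesis using finite_subset by blast
    qed
    ultimately show False by (rule omega1_gap_not_separated[OF gap])
  qed
  then obtain p q x where pq: "p \<in> J" "p \<noteq> r" "q \<in> J" "q \<noteq> r" and x: "x \<in> Linf p" "x \<in> Rinf q"
    by auto
  have "p \<noteq> q"
  proof
    assume "p = q"
    obtain \<alpha> where "\<alpha> \<in> p - r" using J(3)[OF pq(1)] pq(2) by blast
    with x \<open>p = q\<close> disj[of \<alpha>] show False by (auto simp: Linf_def Rinf_def)
  qed
  moreover have "clique (gap_edge L R) (p \<union> q)"
  proof (rule clique_Un)
    show "clique (gap_edge L R) p" "clique (gap_edge L R) q"
      using pq J(1) \<A>(1) by (auto simp: finite_cliques_def)
    show "gap_edge L R \<alpha> \<beta>" if "\<alpha> \<in> p - q" "\<beta> \<in> q - p" for \<alpha> \<beta>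
    proof -
      have "\<alpha> \<in> p - r" "\<beta> \<in> q - r" using that J(3) pq by auto
      with x show ?thesis by (auto simp: gap_edge_def Linf_def Rinf_def)
    qed
  qed (simp add: gap_edge_commute)
  ultimately show "\<exists>a\<in>\<A>. \<exists>b\<in>\<A>. a \<noteq> b \<and> clique (gap_edge L R) (a \<union> b)"
    using pq J(1) by blast
qed

text \<open>The union of the \<open>L \<alpha>\<close> over \<open>A\<close> misses every
  \<open>R \<alpha>\<close> with \<open>\<alpha>\<close> in \<open>A\<close>; if \<open>A\<close> is
  unbounded, it separates the whole gap.\<close>

lemma omega1_gap_no_uncountable_nonedge_clique:
  assumes gap: "omega1_gap L R" and disj: "\<And>\<alpha>. L \<alpha> \<inter> R \<alpha> = {}"
    and A: "clique (gap_nonedge L R) A"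
  shows "countable A"
proof (rule ccontr)
  assume "uncountable A"
  then have unb: "\<exists>\<alpha>\<in>A. \<delta> \<le> \<alpha>" for \<delta> by (rule uncountable_imp_unbounded)
  define C where "C = (\<Union>\<alpha>\<in>A. L \<alpha>)"
  have "L \<beta> \<inter> R \<alpha> = {}" if "\<alpha> \<in> A" "\<beta> \<in> A" for \<alpha> \<beta>
    using A that disj[of \<alpha>] by (cases "\<alpha> = \<beta>") (auto simp: clique_def gap_edge_def)
  then have CR: "C \<inter> R \<alpha> = {}" if "\<alpha> \<in> A" for \<alpha>
    using that by (auto simp: C_def)
  have "finite (L \<delta> - C)" for \<delta>
  proof -
    obtain \<alpha> where \<alpha>: "\<alpha> \<in> A" "\<delta> \<le> \<alpha>" using unb by blast
    then have "L \<delta> - C \<subseteq> L \<delta> - L \<alpha>" by (auto simp: C_def)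
    then show ?thesis using omega1_gap_almost_subset(1)[OF gap \<alpha>(2)] finite_subset by blast
  qed
  moreover have "finite (C \<inter> R \<delta>)" for \<delta>
  proof -
    obtain \<alpha> where \<alpha>: "\<alpha> \<in> A" "\<delta> \<le> \<alpha>" using unb by blast
    have "C \<inter> R \<delta> \<subseteq> R \<delta> - R \<alpha>" using CR[OF \<alpha>(1)] by auto
    then show ?thesis using omega1_gap_almost_subset(2)[OF gap \<alpha>(2)] finite_subset by blast
  qed
  ultimately show False by (rule omega1_gap_not_separated[OF gap])
qed

section \<open>Traces below a bound and names for a separating set\<close>

definition traces :: "('a \<Rightarrow> nat set) \<Rightarrow> ('a \<Rightarrow> nat set) \<Rightarrow> nat \<Rightarrow> 'a set \<Rightarrow> (nat set \<times> nat set) set" where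
  "traces L R k a = (\<lambda>\<alpha>. (L \<alpha> \<inter> {..<k}, R \<alpha> \<inter> {..<k})) ` a"

definition all_traces :: "(nat set \<times> nat set) set set" where
  "all_traces = {T. finite T \<and> T \<subseteq> {E. finite E} \<times> {E. finite E}}"

lemma countable_all_traces: "countable all_traces"
  unfolding all_traces_def
  by (intro countable_Collect_finite_subset countable_SIGMA countable_Collect_finite)

lemma traces_in_all_traces: "finite a \<Longrightarrow> traces L R k a \<in> all_traces"
  by (auto simp: traces_def all_traces_def)

text \<open>Below \<open>k\<close> every point of \<open>a\<close> has a twin in \<open>b\<close>
  with the same values of \<open>L\<close> and \<open>R\<close>. A witness \<open>x < k\<close> for
  \<open>\<alpha>\<close> and \<open>\<beta>\<close> would also join the twin of
  \<open>\<alpha>\<close> to \<open>\<beta>\<close> inside the independent set \<open>b\<close>;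
  these two points differ because \<open>L \<beta>\<close> and \<open>R \<beta>\<close> are
  disjoint.\<close>

lemma traces_eq_imp_ge:
  assumes disj: "\<And>\<alpha>. L \<alpha> \<inter> R \<alpha> = {}" and b: "clique (gap_nonedge L R) b"
    and eq: "traces L R k a = traces L R k b"
    and \<alpha>\<beta>: "\<alpha> \<in> a" "\<beta> \<in> b" "x \<in> L \<alpha>" "x \<in> R \<beta>"
  shows "k \<le> x"
proof (rule ccontr)
  assume "\<not> k \<le> x"
  have "(L \<alpha> \<inter> {..<k}, R \<alpha> \<inter> {..<k}) \<in> traces L R k b"
    using \<alpha>\<beta>(1) unfolding eq[symmetric] by (simp add: traces_def)
  then obtain \<gamma> where \<gamma>: "\<gamma> \<in> b" "L \<alpha> \<inter> {..<k} = L \<gamma> \<inter> {..<k}"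
    by (auto simp: traces_def)
  have "x \<in> L \<alpha> \<inter> {..<k}" using \<alpha>\<beta>(3) \<open>\<not> k \<le> x\<close> by simp
  then have x: "x \<in> L \<gamma>" unfolding \<gamma>(2) by simp
  then have "\<gamma> \<noteq> \<beta>" using disj[of \<beta>] \<alpha>\<beta>(4) by auto
  then show False
    using b \<gamma>(1) \<alpha>\<beta>(2,4) x by (auto simp: clique_def gap_edge_def)
qed

text \<open>From \<open>k\<close> on, \<open>t\<close> forces \<open>C\<close> to contain
  \<open>L \<alpha>\<close> and to avoid \<open>R \<alpha>\<close>. Containment stays doubly
  negated, the form in which \<open>f_separated\<close> supplies it.\<close>

definition decided_above ::
    "'q rel \<Rightarrow> (omega1 \<Rightarrow> nat set) \<Rightarrow> (omega1 \<Rightarrow> nat set) \<Rightarrow> (nat \<times> 'q) set \<Rightarrow> omega1 \<Rightarrow> nat \<Rightarrow> 'q \<Rightarrow> bool" where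
  "decided_above P L R C \<alpha> k t \<longleftrightarrow> (\<forall>x\<ge>k. \<forall>q. (q, t) \<in> P \<longrightarrow>
     (x \<in> L \<alpha> \<longrightarrow> \<not> f_not P (f_mem P x C) q) \<and> (x \<in> R \<alpha> \<longrightarrow> \<not> f_mem P x C q))"

lemma decided_above_mono:
  assumes "Preorder P" and "decided_above P L R C \<alpha> k s" and "(t, s) \<in> P" and "k \<le> l"
  shows "decided_above P L R C \<alpha> l t"
  using assms(2) Preorder_trans[OF assms(1) _ assms(3)] assms(4)
  unfolding decided_above_def by (meson order_trans)

lemma decided_above_disjoint:
  assumes "Preorder P" and "decided_above P L R C \<alpha> k t" and "decided_above P L R C \<beta> k t"
    and "t \<in> Field P" and "k \<le> x" and "x \<in> L \<alpha>" and "x \<in> R \<beta>"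
  shows False
proof -
  have "\<not> f_not P (f_mem P x C) t"
    using assms(2,5,6) Preorder_refl[OF assms(1,4)] unfolding decided_above_def by blast
  moreover have "f_not P (f_mem P x C) t"
    using assms(3,5,7) unfolding decided_above_def f_not_def by blast
  ultimately show False by blast
qed

lemma decided_above_finite:
  assumes pre: "Preorder P" and "finite A" and "(s, p) \<in> P"
    and ex: "\<And>\<alpha> s. (s, p) \<in> P \<Longrightarrow> \<exists>t k. (t, s) \<in> P \<and> decided_above P L R C \<alpha> k t"
  shows "\<exists>t k. (t, s) \<in> P \<and> (\<forall>\<alpha>\<in>A. decided_above P L R C \<alpha> k t)"
  using assms(2)
proof (induction A)
  case empty
  have "(s, s) \<in> P" using assms(3) by (intro Preorder_refl[OF pre]) (auto simp: Field_def)
  then show ?case by blast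
next
  case (insert \<alpha> A)
  then obtain t k where t: "(t, s) \<in> P" "\<forall>\<alpha>\<in>A. decided_above P L R C \<alpha> k t" by blast
  obtain u l where u: "(u, t) \<in> P" "decided_above P L R C \<alpha> l u"
    using ex[OF Preorder_trans[OF pre t(1) assms(3)]] by blast
  have "(u, u) \<in> P" using u(1) by (intro Preorder_refl[OF pre]) (auto simp: Field_def)
  then have "decided_above P L R C \<alpha> (max k l) u"
    using decided_above_mono[OF pre u(2)] by simp
  moreover have "decided_above P L R C \<beta> (max k l) u" if "\<beta> \<in> A" for \<beta>
    using decided_above_mono[OF pre t(2)[rule_format, OF that] u(1)] by simp
  moreover have "(u, s) \<in> P" using Preorder_trans[OF pre u(1) t(1)] .
  ultimately show ?case by blast
qed

lemma f_finite_obtain: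
  assumes "f_finite P \<phi> s" and "(s, s) \<in> P"
  obtains t E where "(t, s) \<in> P" and "finite E" and "\<And>x q. x \<notin> E \<Longrightarrow> (q, t) \<in> P \<Longrightarrow> \<not> \<phi> x q"
proof -
  obtain t E where "(t, s) \<in> P" "finite E" "f_all (- E) (\<lambda>x. f_not P (\<phi> x)) t"
    using assms unfolding f_finite_def f_ex_def by blast
  with that show thesis by (auto simp: f_all_def f_not_def)
qed

lemma f_finite_mono:
  assumes "Preorder P" and "f_finite P \<phi> s" and "(t, s) \<in> P"
  shows "f_finite P \<phi> t"
  using assms(2) Preorder_trans[OF assms(1) _ assms(3)]
  unfolding f_finite_def f_ex_def by blast

text \<open>The name \<open>C\<close> of a separating set is fixed at \<open>p\<close>. Below any
  \<open>s\<close> the two finite exceptional sets of \<open>\<alpha>\<close> can be decided one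
  after the other, and \<open>k\<close> bounds both.\<close>

lemma destructible_decided_above:
  assumes "destructible TYPE('q) L R"
  obtains P :: "'q rel" and p C where "Preorder P" and "omega1_preserving P" and "p \<in> Field P"
    and "\<And>\<alpha> s. (s, p) \<in> P \<Longrightarrow> \<exists>t k. (t, s) \<in> P \<and> decided_above P L R C \<alpha> k t"
proof -
  obtain P :: "'q rel" and p0 where "forcing_notion P" and pres: "omega1_preserving P"
    and p0: "p0 \<in> Field P" and sep: "f_separated P L R p0"
    using assms unfolding destructible_def by blast
  then have pre: "Preorder P" by (simp add: forcing_notion_def)
  have refl: "(t, t) \<in> P" if "(t, s) \<in> P" for t s
    using that by (intro Preorder_refl[OF pre]) (auto simp: Field_def)
  obtain p C where p: "(p, p0) \<in> P"
    and fL: "\<And>\<alpha>. f_finite P (\<lambda>k. f_and (f_ground (k \<in> L \<alpha>)) (f_not P (f_mem P k C))) p"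
    and fR: "\<And>\<alpha>. f_finite P (\<lambda>k. f_and (f_mem P k C) (f_ground (k \<in> R \<alpha>))) p"
    using sep[unfolded f_separated_def f_ex_def[of _ "names P UNIV"], rule_format,
        OF Preorder_refl[OF pre p0]]
    unfolding f_all_def f_and_def[of "f_finite _ _"] by blast
  show thesis
  proof (rule that[of P p C, OF pre pres])
    show "p \<in> Field P" using p by (auto simp: Field_def)
    fix \<alpha> s assume sp: "(s, p) \<in> P"
    obtain t E where t: "(t, s) \<in> P" "finite E"
      "\<And>x q. x \<notin> E \<Longrightarrow> (q, t) \<in> P \<Longrightarrow> \<not> f_and (f_ground (x \<in> L \<alpha>)) (f_not P (f_mem P x C)) q"
      using f_finite_obtain[OF f_finite_mono[OF pre fL sp] refl[OF sp]] by metis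
    have tp: "(t, p) \<in> P" using Preorder_trans[OF pre t(1) sp] .
    obtain u E' where u: "(u, t) \<in> P" "finite E'"
      "\<And>x q. x \<notin> E' \<Longrightarrow> (q, u) \<in> P \<Longrightarrow> \<not> f_and (f_mem P x C) (f_ground (x \<in> R \<alpha>)) q"
      using f_finite_obtain[OF f_finite_mono[OF pre fR tp] refl[OF tp]] by metis
    obtain k where k: "\<And>x. x \<in> E \<union> E' \<Longrightarrow> x < k"
      using t(2) u(2) finite_nat_set_iff_bounded[of "E \<union> E'"] by auto
    have "decided_above P L R C \<alpha> k u"
      unfolding decided_above_def
    proof (intro allI impI conjI)
      fix x q assume x: "k \<le> x" and q: "(q, u) \<in> P"
      have nE: "x \<notin> E" "x \<notin> E'" using k x by force+
      show "\<not> f_not P (f_mem P x C) q" if "x \<in> L \<alpha>"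
        using t(3)[OF nE(1) Preorder_trans[OF pre q u(1)]] that by (simp add: f_and_def f_ground_def)
      show "\<not> f_mem P x C q" if "x \<in> R \<alpha>"
        using u(3)[OF nE(2) q] that by (simp add: f_and_def f_ground_def)
    qed
    then show "\<exists>t k. (t, s) \<in> P \<and> decided_above P L R C \<alpha> k t"
      using Preorder_trans[OF pre u(1) t(1)] by blast
  qed
qed

text \<open>Each \<open>a \<xi>\<close> receives a bound \<open>k\<close> beyond which
  \<open>C\<close> is decided on all its points, together with its traces below \<open>k\<close>.
  These data come from a countable set, so two sets share them under one condition. An edge between
  the two would need a witness that is at least \<open>k\<close> by the traces and below
  \<open>k\<close> by \<open>C\<close>. Destructibility is assumed with \<open>R'\<close> since a
  set separating \<open>L\<close> from \<open>R'\<close> also separates it from the smaller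
  \<open>R\<close>.\<close>

lemma gap_nonedge_ccc:
  assumes "destructible TYPE('q) L R'" and sub: "\<And>\<alpha>. R \<alpha> \<subseteq> R' \<alpha>" and disj: "\<And>\<alpha>. L \<alpha> \<inter> R \<alpha> = {}"
  shows "clique_ccc (gap_nonedge L R)"
  unfolding clique_ccc_def
proof (intro allI impI)
  fix \<A> assume \<A>: "\<A> \<subseteq> finite_cliques (gap_nonedge L R) {}" "uncountable \<A>"
  obtain P :: "'q rel" and p C where P: "Preorder P" "omega1_preserving P" "p \<in> Field P"
    and dec: "\<And>\<alpha> s. (s, p) \<in> P \<Longrightarrow> \<exists>t k. (t, s) \<in> P \<and> decided_above P L R' C \<alpha> k t"
    using destructible_decided_above[OF assms(1)] by metis
  obtain a :: "omega1 \<Rightarrow> omega1 set" where "inj a" and ra: "range a \<subseteq> \<A>"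
    using uncountable_obtain_omega1_injection[OF \<A>(2)] .
  have fin: "finite (a \<xi>)" and cl: "clique (gap_nonedge L R) (a \<xi>)" for \<xi>
    using ra \<A>(1) by (auto simp: finite_cliques_def)
  define \<phi> where "\<phi> \<xi> c t \<longleftrightarrow> (case c of (k, T) \<Rightarrow>
      (\<forall>\<alpha>\<in>a \<xi>. decided_above P L R' C \<alpha> k t) \<and> traces L R k (a \<xi>) = T)" for \<xi> c t
  have cK: "countable ((UNIV :: nat set) \<times> all_traces)"
    by (intro countable_SIGMA countable_all_traces) auto
  have mono: "\<phi> \<xi> c t" if "\<phi> \<xi> c s" "(t, s) \<in> P" for \<xi> c s t
    using that decided_above_mono[OF P(1) _ that(2)] by (auto simp: \<phi>_def split: prod.splits)
  have ex: "\<exists>t. \<exists>c\<in>UNIV \<times> all_traces. (t, s) \<in> P \<and> \<phi> \<xi> c t" if "(s, p) \<in> P" for \<xi> s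
  proof -
    have "\<exists>t k. (t, s) \<in> P \<and> (\<forall>\<alpha>\<in>a \<xi>. decided_above P L R' C \<alpha> k t)"
      by (rule decided_above_finite[OF P(1) fin that dec])
    then obtain t k where "(t, s) \<in> P" "\<forall>\<alpha>\<in>a \<xi>. decided_above P L R' C \<alpha> k t" by blast
    then show ?thesis
      by (intro exI[of _ t] bexI[of _ "(k, traces L R k (a \<xi>))"])
        (auto simp: \<phi>_def traces_in_all_traces fin)
  qed
  have "\<exists>t \<xi> \<eta>. \<exists>c\<in>UNIV \<times> all_traces. (t, p) \<in> P \<and> \<xi> \<noteq> \<eta> \<and> \<phi> \<xi> c t \<and> \<phi> \<eta> c t"
    by (rule omega1_preserving_pigeonhole[where \<phi> = \<phi>, OF P cK mono ex])
  then obtain t \<xi> \<eta> c where t: "(t, p) \<in> P" "\<xi> \<noteq> \<eta>" and c: "\<phi> \<xi> c t" "\<phi> \<eta> c t"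
    by blast
  define k where "k = fst c"
  have \<xi>: "decided_above P L R' C \<alpha> k t" if "\<alpha> \<in> a \<xi>" for \<alpha>
    using c(1) that by (auto simp: \<phi>_def k_def split: prod.splits)
  have \<eta>: "decided_above P L R' C \<alpha> k t" if "\<alpha> \<in> a \<eta>" for \<alpha>
    using c(2) that by (auto simp: \<phi>_def k_def split: prod.splits)
  have eq: "traces L R k (a \<xi>) = traces L R k (a \<eta>)"
    using c by (auto simp: \<phi>_def k_def split: prod.splits)
  have tF: "t \<in> Field P" using t(1) by (auto simp: Field_def)
  have "clique (gap_nonedge L R) (a \<xi> \<union> a \<eta>)"
  proof (rule clique_Un[OF cl cl])
    fix \<alpha> \<beta> assume \<alpha>\<beta>: "\<alpha> \<in> a \<xi> - a \<eta>" "\<beta> \<in> a \<eta> - a \<xi>"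
    have "x \<notin> R \<beta>" if "x \<in> L \<alpha>" for x
      using traces_eq_imp_ge[OF disj cl eq, of \<alpha> \<beta> x] decided_above_disjoint[OF P(1) \<xi> \<eta> tF, of \<alpha> \<beta> x]
        that sub[of \<beta>] \<alpha>\<beta> by blast
    moreover have "x \<notin> R \<alpha>" if "x \<in> L \<beta>" for x
      using traces_eq_imp_ge[OF disj cl eq[symmetric], of \<beta> \<alpha> x]
        decided_above_disjoint[OF P(1) \<eta> \<xi> tF, of \<beta> \<alpha> x] that sub[of \<alpha>] \<alpha>\<beta> by blast
    ultimately show "\<not> gap_edge L R \<alpha> \<beta>" by (auto simp: gap_edge_def)
  qed (simp add: gap_edge_commute)
  moreover have "a \<xi> \<noteq> a \<eta>" using t(2) \<open>inj a\<close> by (auto dest: injD)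
  ultimately show "\<exists>a\<in>\<A>. \<exists>b\<in>\<A>. a \<noteq> b \<and> clique (gap_nonedge L R) (a \<union> b)"
    using ra by blast
qed

text \<open>The singletons of points of \<open>A\<close> are pairwise incompatible in the forcing
  with finite independent sets.\<close>

lemma no_uncountable_clique_of_complement_ccc:
  assumes "clique_ccc (\<lambda>\<alpha> \<beta>. \<not> e \<alpha> \<beta>)" and "clique e A"
  shows "countable A"
proof (rule ccontr)
  assume "uncountable A"
  then have "uncountable ((\<lambda>\<alpha>. {\<alpha>}) ` A)" by (simp add: countable_image_inj_eq)
  moreover have "(\<lambda>\<alpha>. {\<alpha>}) ` A \<subseteq> finite_cliques (\<lambda>\<alpha> \<beta>. \<not> e \<alpha> \<beta>) {}"
    by (auto simp: finite_cliques_def clique_def)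
  ultimately obtain a b where "a \<in> (\<lambda>\<alpha>. {\<alpha>}) ` A" "b \<in> (\<lambda>\<alpha>. {\<alpha>}) ` A" "a \<noteq> b"
    "clique (\<lambda>\<alpha> \<beta>. \<not> e \<alpha> \<beta>) (a \<union> b)"
    by (rule clique_cccD[OF assms(1)])
  then show False using assms(2) by (auto simp: clique_def)
qed

lemma finitely_many_almost_inclusions:
  assumes gap: "omega1_gap L R" and "finite a" and "finite b"
  shows "\<exists>k. \<forall>\<gamma>\<in>a. \<forall>\<alpha>\<in>b. \<gamma> \<le> \<alpha> \<longrightarrow>
    (\<forall>x\<ge>k. (x \<in> L \<gamma> \<longrightarrow> x \<in> L \<alpha>) \<and> (x \<in> R \<gamma> \<longrightarrow> x \<in> R \<alpha>))"
proof -
  define X where "X = (\<Union>\<gamma>\<in>a. \<Union>\<alpha>\<in>{\<alpha>\<in>b. \<gamma> \<le> \<alpha>}. (L \<gamma> - L \<alpha>) \<union> (R \<gamma> - R \<alpha>))"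
  have "finite X"
    unfolding X_def using assms(2,3) omega1_gap_almost_subset[OF gap] by (intro finite_UN_I) auto
  then obtain k where k: "\<forall>x\<in>X. x < k"
    using finite_nat_set_iff_bounded by blast
  show ?thesis
  proof (intro exI[of _ k] ballI impI allI)
    fix \<gamma> \<alpha> x assume *: "\<gamma> \<in> a" "\<alpha> \<in> b" "\<gamma> \<le> \<alpha>" "k \<le> x"
    then have "x \<notin> X" using k leD by blast
    with * show "(x \<in> L \<gamma> \<longrightarrow> x \<in> L \<alpha>) \<and> (x \<in> R \<gamma> \<longrightarrow> x \<in> R \<alpha>)"
      unfolding X_def by blast
  qed
qed


section \<open>One of the two forcings preserves capturing\<close>

text \<open>Coding a subset of a finite \<open>U\<close> by natural numbers leaves countably many
  codes, so uncountably many pairs can share one.\<close>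

definition positions :: "omega1 set \<Rightarrow> omega1 set \<Rightarrow> nat set" where
  "positions A U = {a. a < card U \<and> nth_elem U a \<in> A}"

lemma nth_elem_positions:
  assumes "finite U" and "A \<subseteq> U"
  shows "nth_elem U ` positions A U = A"
proof
  show "A \<subseteq> nth_elem U ` positions A U"
  proof
    fix x assume x: "x \<in> A"
    with assms obtain a where "a < card U" "x = nth_elem U a"
      using ex_nth_elem[of U x] by blast
    with x show "x \<in> nth_elem U ` positions A U" by (auto simp: positions_def)
  qed
qed (auto simp: positions_def)

lemma positions_subset: "positions A U \<subseteq> {..<card U}"
  by (auto simp: positions_def)

lemma capturing_edge_nonedge_false:
  assumes cap: "capturing m n r F 2"
    and gap: "omega1_gap L R" and disj: "\<And>\<alpha>. L \<alpha> \<inter> R \<alpha> = {}"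
    and \<D>: "uncountable \<D>" "\<And>A. A \<in> \<D> \<Longrightarrow> finite A"
    and c: "\<And>A. A \<in> \<D> \<Longrightarrow> finite (c A) \<and> clique (gap_edge L R) (c A)"
    and X: "finite X"
    and cinc: "\<And>D l. inj_on D {..<2} \<Longrightarrow> D ` {..<2} \<subseteq> \<D> \<Longrightarrow> captured m n r F 2 D l \<Longrightarrow> l \<notin> X \<Longrightarrow>
      \<not> clique (gap_edge L R) (c (D 0) \<union> c (D (1::nat)))"
    and \<E>: "uncountable \<E>" "\<And>A. A \<in> \<E> \<Longrightarrow> finite A"
    and d: "\<And>A. A \<in> \<E> \<Longrightarrow> finite (d A) \<and> clique (gap_nonedge L R) (d A)"
    and Y: "finite Y"
    and dinc: "\<And>D l. inj_on D {..<2} \<Longrightarrow> D ` {..<2} \<subseteq> \<E> \<Longrightarrow> captured m n r F 2 D l \<Longrightarrow> l \<notin> Y \<Longrightarrow>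
      \<not> clique (gap_nonedge L R) (d (D 0) \<union> d (D (1::nat)))"
  shows False
proof -
  have finc: "finite (c A)" if "A \<in> \<D>" for A using c[OF that] by simp
  obtain \<rho> J where "finite \<rho>" and J: "J \<subseteq> \<D>" "uncountable J" "\<And>A. A \<in> J \<Longrightarrow> \<rho> \<subseteq> c A"
    and cnt: "\<And>\<alpha>. \<alpha> \<notin> \<rho> \<Longrightarrow> countable {A\<in>J. \<alpha> \<in> c A}"
    by (rule finite_sets_root[OF \<D>(1), of c, OF finc]; blast)
  obtain e :: "omega1 \<Rightarrow> omega1 set" where "inj e" and e: "\<And>\<xi>. e \<xi> \<in> \<E>"
    using uncountable_obtain_omega1_injection[OF \<E>(1)] by (metis rangeI subsetD)
  \<comment> \<open>All but countably many \<open>A\<close> in \<open>J\<close> have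
    \<open>c A\<close> above \<open>d (e \<xi>)\<close> outside the root, so the partner
    \<open>g \<xi>\<close> of \<open>e \<xi>\<close> can be chosen injectively.\<close>
  have "uncountable {A. A \<in> J \<and> (\<forall>\<gamma>\<in>d (e \<xi>). \<forall>\<alpha>\<in>c A - \<rho>. \<gamma> \<le> \<alpha>)}" for \<xi>
  proof
    assume cn: "countable {A. A \<in> J \<and> (\<forall>\<gamma>\<in>d (e \<xi>). \<forall>\<alpha>\<in>c A - \<rho>. \<gamma> \<le> \<alpha>)}"
    have "countable (d (e \<xi>))" using d[OF e] by (simp add: countable_finite)
    then obtain \<delta> where \<delta>: "\<forall>\<gamma>\<in>d (e \<xi>). \<gamma> < \<delta>" using countable_omega1_bounded by blast
    have sub: "J \<subseteq> {A. A \<in> J \<and> (\<forall>\<gamma>\<in>d (e \<xi>). \<forall>\<alpha>\<in>c A - \<rho>. \<gamma> \<le> \<alpha>)} \<union> {A\<in>J. \<exists>\<alpha>\<in>c A - \<rho>. \<alpha> \<le> \<delta>}"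
    proof
      fix A assume "A \<in> J"
      moreover have "\<gamma> \<le> \<alpha>" if "\<not> (\<exists>\<alpha>\<in>c A - \<rho>. \<alpha> \<le> \<delta>)" "\<gamma> \<in> d (e \<xi>)" "\<alpha> \<in> c A - \<rho>" for \<gamma> \<alpha>
        using that \<delta> by (meson less_imp_le linear order_trans)
      ultimately show "A \<in> {A. A \<in> J \<and> (\<forall>\<gamma>\<in>d (e \<xi>). \<forall>\<alpha>\<in>c A - \<rho>. \<gamma> \<le> \<alpha>)} \<union>
          {A\<in>J. \<exists>\<alpha>\<in>c A - \<rho>. \<alpha> \<le> \<delta>}" by blast
    qed
    have "countable {A\<in>J. \<exists>\<alpha>\<in>c A - \<rho>. \<alpha> \<le> \<delta>}"
      by (rule countable_bounded_below_root[OF cnt])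
    from countable_subset[OF sub countable_Un[OF cn this]] J(2) show False by contradiction
  qed
  then have "\<exists>g. inj g \<and> (\<forall>\<xi>. g \<xi> \<in> J \<and> (\<forall>\<gamma>\<in>d (e \<xi>). \<forall>\<alpha>\<in>c (g \<xi>) - \<rho>. \<gamma> \<le> \<alpha>))"
    by (rule omega1_injective_choice[where T = "\<lambda>\<xi> A. A \<in> J \<and> (\<forall>\<gamma>\<in>d (e \<xi>). \<forall>\<alpha>\<in>c A - \<rho>. \<gamma> \<le> \<alpha>)"])
  then obtain g :: "omega1 \<Rightarrow> omega1 set"
    where "inj g" and gJ: "\<And>\<xi>. g \<xi> \<in> J"
      and above: "\<And>\<xi> \<gamma> \<alpha>. \<gamma> \<in> d (e \<xi>) \<Longrightarrow> \<alpha> \<in> c (g \<xi>) - \<rho> \<Longrightarrow> \<gamma> \<le> \<alpha>"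
    by blast
  have g: "g \<xi> \<in> \<D>" for \<xi> using gJ J(1) by blast
  have "\<exists>k. \<forall>\<gamma>\<in>d (e \<xi>). \<forall>\<alpha>\<in>c (g \<xi>). \<gamma> \<le> \<alpha> \<longrightarrow>
      (\<forall>x\<ge>k. (x \<in> L \<gamma> \<longrightarrow> x \<in> L \<alpha>) \<and> (x \<in> R \<gamma> \<longrightarrow> x \<in> R \<alpha>))" for \<xi>
    using finitely_many_almost_inclusions[OF gap] c[OF g] d[OF e] by blast
  then obtain k where k: "\<And>\<xi>. \<forall>\<gamma>\<in>d (e \<xi>). \<forall>\<alpha>\<in>c (g \<xi>). \<gamma> \<le> \<alpha> \<longrightarrow>
      (\<forall>x\<ge>k \<xi>. (x \<in> L \<gamma> \<longrightarrow> x \<in> L \<alpha>) \<and> (x \<in> R \<gamma> \<longrightarrow> x \<in> R \<alpha>))" by metis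
  have push: "(x \<in> L \<gamma> \<longrightarrow> x \<in> L \<alpha>) \<and> (x \<in> R \<gamma> \<longrightarrow> x \<in> R \<alpha>)"
    if "\<gamma> \<in> d (e \<xi>)" "\<alpha> \<in> c (g \<xi>) - \<rho>" "k \<xi> \<le> x" for \<xi> \<gamma> \<alpha> x
    using k[of \<xi>] that above[OF that(1,2)] by blast
  define U where "U \<xi> = g \<xi> \<union> e \<xi>" for \<xi>
  have finU: "finite (U \<xi>)" for \<xi> using \<D>(2)[OF g] \<E>(2)[OF e] by (simp add: U_def)
  have gU: "nth_elem (U \<xi>) ` positions (g \<xi>) (U \<xi>) = g \<xi>"
    and eU: "nth_elem (U \<xi>) ` positions (e \<xi>) (U \<xi>) = e \<xi>" for \<xi>
    using nth_elem_positions[OF finU] by (simp_all add: U_def)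
  \<comment> \<open>All finite data on which the argument depends. On an uncountable fibre of
    \<open>h\<close> the bound and the traces agree, and both parts of each union sit at the same
    positions, as \<open>captured_subfamily\<close> requires.\<close>
  define h where "h \<xi> = (k \<xi>, traces L R (k \<xi>) (d (e \<xi>)), positions (g \<xi>) (U \<xi>), positions (e \<xi>) (U \<xi>))" for \<xi>
  have "finite (positions A (U \<xi>))" for A \<xi>
    using positions_subset finite_subset by blast
  moreover have "traces L R (k \<xi>) (d (e \<xi>)) \<in> all_traces" for \<xi>
    using d[OF e[of \<xi>]] by (intro traces_in_all_traces) simp
  ultimately have "range h \<subseteq> UNIV \<times> all_traces \<times> {I. finite I} \<times> {I. finite I}"
    by (auto simp: h_def)
  moreover have "countable ((UNIV :: nat set) \<times> all_traces \<times> {I :: nat set. finite I} \<times> {I :: nat set. finite I})"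
    by (intro countable_SIGMA countable_all_traces countable_Collect_finite) auto
  ultimately obtain t where "uncountable {\<xi>\<in>UNIV. h \<xi> = t}"
    using uncountable_fibre[OF uncountable_omega1] by blast
  then have uncZ: "uncountable {\<xi>. h \<xi> = t}" by simp
  obtain k0 T I I' where t: "t = (k0, T, I, I')" by (cases t)
  define Z where "Z = {\<xi>. h \<xi> = t}"
  have Z: "k \<xi> = k0" "traces L R k0 (d (e \<xi>)) = T" "nth_elem (U \<xi>) ` I = g \<xi>"
    "nth_elem (U \<xi>) ` I' = e \<xi>" "I \<subseteq> {..<card (U \<xi>)}" "I' \<subseteq> {..<card (U \<xi>)}" if "\<xi> \<in> Z" for \<xi>
    using that gU[of \<xi>] eU[of \<xi>] unfolding Z_def t h_def by (auto simp: positions_def)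
  \<comment> \<open>Fixed positions recover \<open>g \<xi>\<close> from \<open>U \<xi>\<close>, so
    the unions stay distinct.\<close>
  have injU: "inj_on U Z"
    by (rule inj_onI) (metis Z(3) \<open>inj g\<close> injD)
  have "uncountable (U ` Z)" "U ` Z \<subseteq> {A. finite A}"
    using uncZ injU finU by (auto simp: countable_image_inj_eq Z_def)
  \<comment> \<open>Infinitely many levels leave one outside both exceptional sets \<open>X\<close>
    and \<open>Y\<close>.\<close>
  then have "infinite {l. \<exists>D. inj_on D {..<2} \<and> (\<forall>i<2. D i \<in> U ` Z) \<and> captured m n r F 2 D l}"
    using cap unfolding capturing_def by blast
  then have "\<not> {l. \<exists>D. inj_on D {..<2} \<and> (\<forall>i<2. D i \<in> U ` Z) \<and> captured m n r F 2 D l} \<subseteq> X \<union> Y"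
    using X Y by (meson finite_UnI finite_subset)
  then obtain l D where l: "l \<notin> X" "l \<notin> Y" and D: "inj_on D {..<2}" "\<And>i. i < 2 \<Longrightarrow> D i \<in> U ` Z"
    and Dl: "captured m n r F 2 D l" by blast
  have "\<forall>i. \<exists>\<xi>. i < 2 \<longrightarrow> \<xi> \<in> Z \<and> D i = U \<xi>" using D(2) by blast
  then obtain z where z: "\<And>i::nat. i < 2 \<Longrightarrow> z i \<in> Z" "\<And>i. i < 2 \<Longrightarrow> D i = U (z i)" by metis
  have injz: "inj_on z {..<2}"
    using D(1) z(2) by (auto simp: inj_on_def)
  have Dg: "nth_elem (D i) ` I = g (z i)" and De: "nth_elem (D i) ` I' = e (z i)" if "i < 2" for i
    using z that Z(3,4) by auto
  have I: "I \<subseteq> {..<card (D 0)}" and I': "I' \<subseteq> {..<card (D 0)}"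
    using Z(5,6)[OF z(1)[of 0]] z(2)[of 0] by auto
  have "\<not> clique (gap_edge L R) (c (nth_elem (D 0) ` I) \<union> c (nth_elem (D 1) ` I))"
  proof (rule cinc[OF _ _ captured_subfamily[OF Dl _ I] l(1)])
    \<comment> \<open>Distinctness comes from the injectivity of \<open>g\<close>, as the positions
      in \<open>I\<close> could all lie in the captured root.\<close>
    show "inj_on (\<lambda>i. nth_elem (D i) ` I) {..<2}"
      using injz \<open>inj g\<close> Dg by (auto simp: inj_on_def)
    show "(\<lambda>i. nth_elem (D i) ` I) ` {..<2} \<subseteq> \<D>" using Dg g by auto
  qed simp
  then have cn: "\<not> clique (gap_edge L R) (c (g (z 0)) \<union> c (g (z 1)))"
    using Dg by simp
  have "\<not> clique (gap_nonedge L R) (d (nth_elem (D 0) ` I') \<union> d (nth_elem (D 1) ` I'))"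
  proof (rule dinc[OF _ _ captured_subfamily[OF Dl _ I'] l(2)])
    show "inj_on (\<lambda>i. nth_elem (D i) ` I') {..<2}"
      using injz \<open>inj e\<close> De by (auto simp: inj_on_def)
    show "(\<lambda>i. nth_elem (D i) ` I') ` {..<2} \<subseteq> \<E>" using De e by auto
  qed simp
  then have dn: "\<not> clique (gap_nonedge L R) (d (e (z 0)) \<union> d (e (z 1)))"
    using De by simp
  have zz: "z 0 \<in> Z" "z 1 \<in> Z" using z(1) by auto
  \<comment> \<open>The indices are arbitrary because a witness may lie in \<open>L\<close> on
    either side; the second use exchanges \<open>z 0\<close> and \<open>z 1\<close>.\<close>
  have final: False
    if ij: "i \<in> Z" "j \<in> Z" "\<not> clique (gap_edge L R) (c (g i) \<union> c (g j))"
      and \<gamma>: "\<gamma> \<in> d (e i)" "\<delta> \<in> d (e j)" "x \<in> L \<gamma>" "x \<in> R \<delta>" for i j \<gamma> \<delta> x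
  proof -
    have eq: "traces L R k0 (d (e i)) = traces L R k0 (d (e j))" using Z(2) ij by simp
    have "clique (gap_nonedge L R) (d (e j))" using d[OF e] by blast
    from traces_eq_imp_ge[OF disj this eq \<gamma>] have x: "k0 \<le> x" .
    have "clique (gap_edge L R) (c (g i) \<union> c (g j))"
    proof (rule clique_Un)
      show "clique (gap_edge L R) (c (g i))" "clique (gap_edge L R) (c (g j))"
        using c[OF g] by blast+
      fix \<alpha> \<beta> assume "\<alpha> \<in> c (g i) - c (g j)" "\<beta> \<in> c (g j) - c (g i)"
      \<comment> \<open>Points of \<open>\<rho>\<close> belong to both cliques and so never occur in
        a cross pair; only points above the independent sets remain.\<close>
      then have "\<alpha> \<in> c (g i) - \<rho>" "\<beta> \<in> c (g j) - \<rho>" using J(3)[OF gJ] by auto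
      then have "x \<in> L \<alpha>" "x \<in> R \<beta>"
        using push[OF \<gamma>(1)] push[OF \<gamma>(2)] \<gamma>(3,4) x Z(1)[OF ij(1)] Z(1)[OF ij(2)] by auto
      then show "gap_edge L R \<alpha> \<beta>" by (auto simp: gap_edge_def)
    qed (simp add: gap_edge_commute)
    with ij(3) show False by blast
  qed
  have "clique (gap_nonedge L R) (d (e (z 0)) \<union> d (e (z 1)))"
  proof (rule clique_Un)
    show "clique (gap_nonedge L R) (d (e (z 0)))" "clique (gap_nonedge L R) (d (e (z 1)))"
      using d[OF e] by blast+
    fix \<gamma> \<delta> assume "\<gamma> \<in> d (e (z 0)) - d (e (z 1))" "\<delta> \<in> d (e (z 1)) - d (e (z 0))"
    then show "gap_nonedge L R \<gamma> \<delta>"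
      using final[OF zz cn, of \<gamma> \<delta>] final[OF zz(2,1), of \<delta> \<gamma>] cn
      by (auto simp: gap_edge_def Un_commute)
  qed (simp add: gap_edge_commute)
  with dn show False by blast
qed

theorem mainTheorem14:
  fixes m n r :: "nat \<Rightarrow> nat"
    and F :: "omega1 set set"
    and \<kappa> :: "'p set rel"
  assumes "\<exists>f :: omega1 set \<Rightarrow> 'p. inj f"
    and "construction_scheme m n r F"
    and "capturing m n r F 2"
    and "scheme_martin_number m n r F \<kappa>"
    and "cardSuc natLeq <o \<kappa>"
  shows "\<not> (\<exists>L R. omega1_gap L R \<and> destructible TYPE('q) L R)"
proof
  assume "\<exists>L R. omega1_gap L R \<and> destructible TYPE('q) L R"
  then obtain L R' where gap': "omega1_gap L R'" and des: "destructible TYPE('q) L R'" by blast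
  define R where "R \<alpha> = R' \<alpha> - L \<alpha>" for \<alpha>
  have gap: "omega1_gap L R"
    using omega1_gap_disjointify[OF gap'] by (simp add: R_def[abs_def])
  have disj: "L \<alpha> \<inter> R \<alpha> = {}" for \<alpha> by (auto simp: R_def)
  have edge: "clique_ccc (gap_edge L R)" by (rule gap_edge_ccc[OF gap disj])
  have nonedge: "clique_ccc (gap_nonedge L R)"
    by (rule gap_nonedge_ccc[OF des _ disj]) (auto simp: R_def)
  obtain f :: "omega1 set \<Rightarrow> 'p" where f: "inj f" using assms(1) by blast
  obtain p where p: "p \<in> finite_cliques (gap_edge L R) p"
    and p_ext: "\<And>a \<xi>. a \<in> finite_cliques (gap_edge L R) p \<Longrightarrow>
      \<exists>b\<in>finite_cliques (gap_edge L R) p. a \<subseteq> b \<and> (\<exists>\<alpha>\<in>b. \<xi> \<le> \<alpha>)"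
    by (rule clique_ccc_generic_uncountable[OF edge]; blast)
  obtain q where q: "q \<in> finite_cliques (gap_nonedge L R) q"
    and q_ext: "\<And>a \<xi>. a \<in> finite_cliques (gap_nonedge L R) q \<Longrightarrow>
      \<exists>b\<in>finite_cliques (gap_nonedge L R) q. a \<subseteq> b \<and> (\<exists>\<alpha>\<in>b. \<xi> \<le> \<alpha>)"
    by (rule clique_ccc_generic_uncountable[OF nonedge]; blast)
  have np: "\<not> forced (clique_forcing f (gap_edge L R) p)
      (f_capturing (clique_forcing f (gap_edge L R) p) m n r F 2)"
  proof
    assume forced: "forced (clique_forcing f (gap_edge L R) p)
      (f_capturing (clique_forcing f (gap_edge L R) p) m n r F 2)"
    obtain A where "uncountable A" "clique (gap_edge L R) A"
      by (rule uncountable_clique_of_capturing[OF f assms(3-5) edge p p_ext forced])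
    then show False using no_uncountable_clique_of_complement_ccc[OF nonedge] by blast
  qed
  have nq: "\<not> forced (clique_forcing f (gap_nonedge L R) q)
      (f_capturing (clique_forcing f (gap_nonedge L R) q) m n r F 2)"
  proof
    assume forced: "forced (clique_forcing f (gap_nonedge L R) q)
      (f_capturing (clique_forcing f (gap_nonedge L R) q) m n r F 2)"
    obtain A where "uncountable A" "clique (gap_nonedge L R) A"
      by (rule uncountable_clique_of_capturing[OF f assms(3-5) nonedge q q_ext forced])
    then show False using omega1_gap_no_uncountable_nonedge_clique[OF gap disj] by blast
  qed
  show False
  proof (rule clique_forcing_not_capturing[OF f p np], rule clique_forcing_not_capturing[OF f q nq])
    fix \<D> c X \<E> d Y
    assume "uncountable \<D>" "\<And>A. A \<in> \<D> \<Longrightarrow> finite A"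
      "\<And>A. A \<in> \<D> \<Longrightarrow> finite (c A) \<and> clique (gap_edge L R) (c A)" "finite X"
      "\<And>D l. inj_on D {..<2} \<Longrightarrow> D ` {..<2} \<subseteq> \<D> \<Longrightarrow> captured m n r F 2 D l \<Longrightarrow> l \<notin> X \<Longrightarrow>
        \<not> clique (gap_edge L R) (c (D 0) \<union> c (D (1::nat)))"
      "uncountable \<E>" "\<And>A. A \<in> \<E> \<Longrightarrow> finite A"
      "\<And>A. A \<in> \<E> \<Longrightarrow> finite (d A) \<and> clique (gap_nonedge L R) (d A)" "finite Y"
      "\<And>D l. inj_on D {..<2} \<Longrightarrow> D ` {..<2} \<subseteq> \<E> \<Longrightarrow> captured m n r F 2 D l \<Longrightarrow> l \<notin> Y \<Longrightarrow>
        \<not> clique (gap_nonedge L R) (d (D 0) \<union> d (D (1::nat)))"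
    then show False by (rule capturing_edge_nonedge_false[OF assms(3) gap disj])
  qed
qed

end
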